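(* Let $P\colon E\to B$ be a split cofibration. (i) The strict $\mathbb S$-algebra $F^P=L^P\kappa_P\colon E^{\mathbf 2}\to E$ corresponds to the strict factorization system $$(\Delta_P,\mathrm{Vert}(P)),\qquad \Delta_P=\{\delta^x_u\mid x\in E,\ u\colon Px\to b\}.$$ (ii) The ordinary orthogonal factorization system associated with the strict factorization system in (i) is $$\bigl(\mathrm{CoCart}(P),\,P^{-1}\mathrm{Iso}(B)\bigr).$$
   Context: For $P\colon E\to B$, an arrow $e\colon x\to y$ of $E$ is $P$-cocartesian if for all $g\colon x\to z$ and $v\colon Py\to Pz$ with $Pg=v\,Pe$ there is a unique $h\colon y\to z$ with $he=g$, $Ph=v$; $\mathrm{CoCart}(P)$ is the class of these. An arrow $f$ is vertical if $Pf$ is an identity; $\mathrm{Vert}(P)$ is the wide subcategory of vertical arrows. $P^{-1}\mathrm{Iso}(B)$ is the class of arrows $f$ of $E$ with $Pf$ invertible. A cleavage chooses, for each $x\in E$ and $u\colon Px\to b$, a $P$-cocartesian arrow $\delta^x_u\colon x\to u_!x$ with $P\delta^x_u=u$. For $u\colon a\to b$ it induces a functor $u_!\colon E_a\to E_b$ between fibres by $(u_!f)\delta^x_u=\delta^y_uf$, $u_!f$ vertical. It is split if $\delta^x_{1_{Px}}=1_x$ and $(vu)_!=v_!u_!$, $\delta^x_{vu}=\delta^{u_!x}_v\delta^x_u$ whenever defined. A split cofibration is a functor with a split cleavage. $P\downarrow B$ has objects $(x,u)$ with $u\colon Px\to b$, and arrows $(f,v)\colon(x,u)\to(y,w)$ with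 $f\colon x\to y$, $v\colon b\to c$, $vu=w\,Pf$; $\mathrm{Cod}_P(x,u)=b$, $\mathrm{Cod}_P(f,v)=v$. $L^P\colon P\downarrow B\to E$ is the unique functor with $L^P(x,u)=u_!x$, $PL^P=\mathrm{Cod}_P$, $L^P(f,v)\delta^x_u=\delta^y_wf$. $\kappa_P\colon E^{\mathbf 2}\to P\downarrow B$ is $\kappa_P(f\colon x\to y)=(x,Pf)$, $\kappa_P(r,s)=(r,Ps)$. $\mathbb S$ is the squaring 2-monad on $\mathbf{CAT}$: $\mathbb SE=E^{\mathbf 2}$ (arrows $(r,s)\colon f\to g$ are commutative squares $sf=gr$), unit $I_E\colon x\mapsto1_x$, multiplication $m_E$ sending a square to its diagonal. A strict $\mathbb S$-algebra is $F\colon E^{\mathbf 2}\to E$ with $FI_E=1_E$, $Fm_E=F(F^{\mathbf 2})$; it selects for $f\colon x\to y$ the factorization $f=m_fe_f$ with $e_f=F(1_x,f)$, $m_f=F(f,1_y)$. A strict factorization system on $E$ is a pair $(\mathcal E,\mathcal M)$ of wide subcategories such that every arrow $f$ has a unique expression $f=me$ with $e\in\mathcal E$, $m\in\mathcal M$. The one corresponding to a strict $\mathbb S$-algebra $F$ is $\mathcal E_F=\{f\mid m_f=1\}$, $\mathcal M_F=\{f\mid e_f=1\}$. Its associated ordinary classes are $\mathcal E^{\simeq}=\{f\mid m_f\text{ is invertible}\}$ and $\mathcal M^{\simeq}=\{f\mid e_f\text{ is invertible}\}$. An (ordinary) orthogonal factorization system is a pair of classes closed under composition with isomorphisms such that every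 arrow factors as an arrow of the left class followed by one of the right class and every commutative square from a left-class arrow to a right-class arrow has a unique diagonal. *)

theory Defs
  imports Main
begin

section \<open>Categories and functors\<close>

record ('o, 'a) cat =
  Obj :: "'o set"
  Arr :: "'a set"
  Dom :: "'a \<Rightarrow> 'o"
  Cod :: "'a \<Rightarrow> 'o"
  Idt :: "'o \<Rightarrow> 'a"
  Comp :: "'a \<Rightarrow> 'a \<Rightarrow> 'a" (infixr "\<cdot>\<index>" 70)

definition hom :: "('o, 'a) cat \<Rightarrow> 'o \<Rightarrow> 'o \<Rightarrow> 'a set" where
  "hom C x y = {f \<in> Arr C. Dom C f = x \<and> Cod C f = y}"

locale category =
  fixes C :: "('o, 'a) cat" (structure)
  assumes Dom_Obj: "f \<in> Arr C \<Longrightarrow> Dom C f \<in> Obj C"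
    and Cod_Obj: "f \<in> Arr C \<Longrightarrow> Cod C f \<in> Obj C"
    and Idt_hom: "x \<in> Obj C \<Longrightarrow> Idt C x \<in> hom C x x"
    and Comp_hom: "\<lbrakk>f \<in> hom C x y; g \<in> hom C y z\<rbrakk> \<Longrightarrow> g \<cdot> f \<in> hom C x z"
    and Comp_Idt: "f \<in> hom C x y \<Longrightarrow> f \<cdot> Idt C x = f"
    and Idt_Comp: "f \<in> hom C x y \<Longrightarrow> Idt C y \<cdot> f = f"
    and Comp_assoc:
      "\<lbrakk>f \<in> hom C w x; g \<in> hom C x y; h \<in> hom C y z\<rbrakk> \<Longrightarrow> (h \<cdot> g) \<cdot> f = h \<cdot> (g \<cdot> f)"

definition identities :: "('o, 'a) cat \<Rightarrow> 'a set" where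
  "identities C = Idt C ` Obj C"

definition Iso :: "('o, 'a) cat \<Rightarrow> 'a set" where
  "Iso C = {f \<in> Arr C. \<exists>g \<in> hom C (Cod C f) (Dom C f).
      g \<cdot>\<^bsub>C\<^esub> f = Idt C (Dom C f) \<and> f \<cdot>\<^bsub>C\<^esub> g = Idt C (Cod C f)}"

record ('o, 'a, 'p, 'b) funct =
  fobj :: "'o \<Rightarrow> 'p"
  farr :: "'a \<Rightarrow> 'b"

locale cat_functor = dom: category C + cod: category D
  for C :: "('o, 'a) cat" and D :: "('p, 'b) cat" and F :: "('o, 'a, 'p, 'b) funct" +
  assumes fobj_Obj: "x \<in> Obj C \<Longrightarrow> fobj F x \<in> Obj D"
    and farr_hom: "f \<in> hom C x y \<Longrightarrow> farr F f \<in> hom D (fobj F x) (fobj F y)"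
    and farr_Idt: "x \<in> Obj C \<Longrightarrow> farr F (Idt C x) = Idt D (fobj F x)"
    and farr_Comp: "\<lbrakk>f \<in> hom C x y; g \<in> hom C y z\<rbrakk> \<Longrightarrow>
      farr F (g \<cdot>\<^bsub>C\<^esub> f) = farr F g \<cdot>\<^bsub>D\<^esub> farr F f"

text \<open>The components of a functor are total functions, whose values outside the carriers of its
  domain \<open>C\<close> are irrelevant; hence equality of functors on \<open>C\<close> is the following relation.\<close>

definition functor_eq ::
  "('o, 'a) cat \<Rightarrow> ('o, 'a, 'p, 'b) funct \<Rightarrow> ('o, 'a, 'p, 'b) funct \<Rightarrow> bool" where
  "functor_eq C F G \<longleftrightarrow>
     (\<forall>x \<in> Obj C. fobj F x = fobj G x) \<and> (\<forall>f \<in> Arr C. farr F f = farr G f)"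

definition id_functor :: "('o, 'a, 'o, 'a) funct" where
  "id_functor = \<lparr>fobj = (\<lambda>x. x), farr = (\<lambda>f. f)\<rparr>"

definition comp_functor ::
  "('p, 'b, 'q, 'c) funct \<Rightarrow> ('o, 'a, 'p, 'b) funct \<Rightarrow> ('o, 'a, 'q, 'c) funct"
  (infixr "\<circ>\<^sub>F" 65) where
  "G \<circ>\<^sub>F F = \<lparr>fobj = (\<lambda>x. fobj G (fobj F x)), farr = (\<lambda>f. farr G (farr F f))\<rparr>"

section \<open>Cocartesian and vertical arrows, split cofibrations\<close>

definition CoCart ::
  "('eo, 'ea) cat \<Rightarrow> ('bo, 'ba) cat \<Rightarrow> ('eo, 'ea, 'bo, 'ba) funct \<Rightarrow> 'ea set" where
  "CoCart E B P = {e \<in> Arr E. \<forall>z \<in> Obj E. \<forall>g \<in> hom E (Dom E e) z.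
      \<forall>v \<in> hom B (fobj P (Cod E e)) (fobj P z).
        farr P g = v \<cdot>\<^bsub>B\<^esub> farr P e \<longrightarrow>
        (\<exists>!h. h \<in> hom E (Cod E e) z \<and> h \<cdot>\<^bsub>E\<^esub> e = g \<and> farr P h = v)}"

definition Vert ::
  "('eo, 'ea) cat \<Rightarrow> ('bo, 'ba) cat \<Rightarrow> ('eo, 'ea, 'bo, 'ba) funct \<Rightarrow> 'ea set" where
  "Vert E B P = {f \<in> Arr E. farr P f \<in> identities B}"

definition inverse_Iso ::
  "('eo, 'ea) cat \<Rightarrow> ('bo, 'ba) cat \<Rightarrow> ('eo, 'ea, 'bo, 'ba) funct \<Rightarrow> 'ea set" where
  "inverse_Iso E B P = {f \<in> Arr E. farr P f \<in> Iso B}"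

definition fibre ::
  "('eo, 'ea) cat \<Rightarrow> ('bo, 'ba) cat \<Rightarrow> ('eo, 'ea, 'bo, 'ba) funct \<Rightarrow> 'bo \<Rightarrow> ('eo, 'ea) cat" where
  "fibre E B P a = E\<lparr>Obj := {x \<in> Obj E. fobj P x = a}, Arr := {f \<in> Arr E. farr P f = Idt B a}\<rparr>"

text \<open>\<open>\<delta> x u\<close> stands for $\delta^x_u$; it is meaningful only if the domain of \<open>u\<close> is \<open>fobj P x\<close>.\<close>

locale cleavage = cat_functor E B P
  for E :: "('eo, 'ea) cat" and B :: "('bo, 'ba) cat" and P :: "('eo, 'ea, 'bo, 'ba) funct" +
  fixes \<delta> :: "'eo \<Rightarrow> 'ba \<Rightarrow> 'ea"
  assumes cleavage_CoCart: "\<lbrakk>x \<in> Obj E; u \<in> Arr B; Dom B u = fobj P x\<rbrakk> \<Longrightarrow> \<delta> x u \<in> CoCart E B P"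
    and cleavage_Dom: "\<lbrakk>x \<in> Obj E; u \<in> Arr B; Dom B u = fobj P x\<rbrakk> \<Longrightarrow> Dom E (\<delta> x u) = x"
    and cleavage_over: "\<lbrakk>x \<in> Obj E; u \<in> Arr B; Dom B u = fobj P x\<rbrakk> \<Longrightarrow> farr P (\<delta> x u) = u"

text \<open>\<open>pushforward E B P \<delta> u\<close> is $u_!$; for \<open>u \<in> hom B a b\<close> it is a functor from the fibre over \<open>a\<close>
  to the fibre over \<open>b\<close> (\<open>pushforward_functor\<close> below).\<close>

definition pushforward ::
  "('eo, 'ea) cat \<Rightarrow> ('bo, 'ba) cat \<Rightarrow> ('eo, 'ea, 'bo, 'ba) funct \<Rightarrow> ('eo \<Rightarrow> 'ba \<Rightarrow> 'ea) \<Rightarrow>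
   'ba \<Rightarrow> ('eo, 'ea, 'eo, 'ea) funct" where
  "pushforward E B P \<delta> u =
     \<lparr>fobj = (\<lambda>x. Cod E (\<delta> x u)),
      farr = (\<lambda>f. THE k. k \<in> hom E (Cod E (\<delta> (Dom E f) u)) (Cod E (\<delta> (Cod E f) u)) \<and>
                k \<in> Vert E B P \<and> k \<cdot>\<^bsub>E\<^esub> \<delta> (Dom E f) u = \<delta> (Cod E f) u \<cdot>\<^bsub>E\<^esub> f)\<rparr>"

locale split_cofibration = cleavage E B P \<delta>
  for E :: "('eo, 'ea) cat" and B :: "('bo, 'ba) cat" and P :: "('eo, 'ea, 'bo, 'ba) funct"
    and \<delta> :: "'eo \<Rightarrow> 'ba \<Rightarrow> 'ea" +
  assumes split_Idt: "x \<in> Obj E \<Longrightarrow> \<delta> x (Idt B (fobj P x)) = Idt E x"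
    and split_pushforward: "\<lbrakk>u \<in> hom B a b; v \<in> hom B b c\<rbrakk> \<Longrightarrow>
      functor_eq (fibre E B P a) (pushforward E B P \<delta> (v \<cdot>\<^bsub>B\<^esub> u))
        (pushforward E B P \<delta> v \<circ>\<^sub>F pushforward E B P \<delta> u)"
    and split_Comp: "\<lbrakk>x \<in> Obj E; u \<in> hom B (fobj P x) b; v \<in> hom B b c\<rbrakk> \<Longrightarrow>
      \<delta> x (v \<cdot>\<^bsub>B\<^esub> u) = \<delta> (fobj (pushforward E B P \<delta> u) x) v \<cdot>\<^bsub>E\<^esub> \<delta> x u"

definition Delta ::
  "('eo, 'ea) cat \<Rightarrow> ('bo, 'ba) cat \<Rightarrow> ('eo, 'ea, 'bo, 'ba) funct \<Rightarrow> ('eo \<Rightarrow> 'ba \<Rightarrow> 'ea) \<Rightarrow> 'ea set" where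
  "Delta E B P \<delta> = {\<delta> x u | x u. x \<in> Obj E \<and> u \<in> Arr B \<and> Dom B u = fobj P x}"

section \<open>The squaring monad and its strict algebras\<close>

text \<open>The arrow \<open>(r, s) : f \<rightarrow> g\<close> of the arrow category is encoded as \<open>(f, g, r, s)\<close>, since an arrow
  has to determine its domain and codomain.\<close>

type_synonym 'a square = "'a \<times> 'a \<times> 'a \<times> 'a"

definition arrow_cat :: "('o, 'a) cat \<Rightarrow> ('a, 'a square) cat" where
  "arrow_cat E =
     \<lparr>Obj = Arr E,
      Arr = {(f, g, r, s). f \<in> Arr E \<and> g \<in> Arr E \<and> r \<in> hom E (Dom E f) (Dom E g) \<and>
              s \<in> hom E (Cod E f) (Cod E g) \<and> s \<cdot>\<^bsub>E\<^esub> f = g \<cdot>\<^bsub>E\<^esub> r},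
      Dom = (\<lambda>(f, g, r, s). f),
      Cod = (\<lambda>(f, g, r, s). g),
      Idt = (\<lambda>f. (f, f, Idt E (Dom E f), Idt E (Cod E f))),
      Comp = (\<lambda>(g, h, r', s') (f, g', r, s). (f, h, r' \<cdot>\<^bsub>E\<^esub> r, s' \<cdot>\<^bsub>E\<^esub> s))\<rparr>"

definition arrow_functor ::
  "('o, 'a, 'p, 'b) funct \<Rightarrow> ('a, 'a square, 'b, 'b square) funct" where
  "arrow_functor F =
     \<lparr>fobj = farr F, farr = (\<lambda>(f, g, r, s). (farr F f, farr F g, farr F r, farr F s))\<rparr>"

definition S_unit :: "('o, 'a) cat \<Rightarrow> ('o, 'a, 'a, 'a square) funct" where
  "S_unit E =
     \<lparr>fobj = Idt E, farr = (\<lambda>f. (Idt E (Dom E f), Idt E (Cod E f), f, f))\<rparr>"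

text \<open>A square \<open>(f, g, r, s)\<close> has diagonal \<open>s \<cdot> f = g \<cdot> r\<close>. An arrow \<open>(\<alpha>, \<beta>) : \<sigma> \<rightarrow> \<tau>\<close> between
  squares consists of four arrows of \<open>E\<close> (a commutative cube), of which the multiplication keeps
  those between the corners on the diagonals: the first component of \<open>\<alpha>\<close> and the second of \<open>\<beta>\<close>.\<close>

definition diagonal :: "('o, 'a) cat \<Rightarrow> 'a square \<Rightarrow> 'a" where
  "diagonal E = (\<lambda>(f, g, r, s). s \<cdot>\<^bsub>E\<^esub> f)"

definition S_mult :: "('o, 'a) cat \<Rightarrow> ('a square, 'a square square, 'a, 'a square) funct" where
  "S_mult E =
     \<lparr>fobj = diagonal E,
      farr = (\<lambda>(\<sigma>, \<tau>, (f, f', r, r'), (g, g', s, s')). (diagonal E \<sigma>, diagonal E \<tau>, r, s'))\<rparr>"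

definition strict_S_algebra :: "('o, 'a) cat \<Rightarrow> ('a, 'a square, 'o, 'a) funct \<Rightarrow> bool" where
  "strict_S_algebra E F \<longleftrightarrow>
     cat_functor (arrow_cat E) E F \<and>
     functor_eq E (F \<circ>\<^sub>F S_unit E) id_functor \<and>
     functor_eq (arrow_cat (arrow_cat E)) (F \<circ>\<^sub>F S_mult E) (F \<circ>\<^sub>F arrow_functor F)"

section \<open>Factorization systems\<close>

definition left_factor :: "('o, 'a) cat \<Rightarrow> ('a, 'a square, 'o, 'a) funct \<Rightarrow> 'a \<Rightarrow> 'a" where
  "left_factor E F f = farr F (Idt E (Dom E f), f, Idt E (Dom E f), f)"

definition right_factor :: "('o, 'a) cat \<Rightarrow> ('a, 'a square, 'o, 'a) funct \<Rightarrow> 'a \<Rightarrow> 'a" where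
  "right_factor E F f = farr F (f, Idt E (Cod E f), f, Idt E (Cod E f))"

definition wide_subcategory :: "('o, 'a) cat \<Rightarrow> 'a set \<Rightarrow> bool" where
  "wide_subcategory E S \<longleftrightarrow>
     S \<subseteq> Arr E \<and> identities E \<subseteq> S \<and>
     (\<forall>f \<in> S. \<forall>g \<in> S. Cod E f = Dom E g \<longrightarrow> g \<cdot>\<^bsub>E\<^esub> f \<in> S)"

definition strict_factorization_system :: "('o, 'a) cat \<Rightarrow> 'a set \<times> 'a set \<Rightarrow> bool" where
  "strict_factorization_system E = (\<lambda>(L, R).
     wide_subcategory E L \<and> wide_subcategory E R \<and>
     (\<forall>f \<in> Arr E. \<exists>!p. fst p \<in> L \<and> snd p \<in> R \<and> Cod E (fst p) = Dom E (snd p) \<and>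
        f = snd p \<cdot>\<^bsub>E\<^esub> fst p))"

definition orthogonal_factorization_system :: "('o, 'a) cat \<Rightarrow> 'a set \<times> 'a set \<Rightarrow> bool" where
  "orthogonal_factorization_system E = (\<lambda>(L, R).
     (\<forall>K \<in> {L, R}. K \<subseteq> Arr E \<and>
        (\<forall>f \<in> K. \<forall>i \<in> Iso E. (Cod E f = Dom E i \<longrightarrow> i \<cdot>\<^bsub>E\<^esub> f \<in> K) \<and>
                           (Cod E i = Dom E f \<longrightarrow> f \<cdot>\<^bsub>E\<^esub> i \<in> K))) \<and>
     (\<forall>f \<in> Arr E. \<exists>e \<in> L. \<exists>m \<in> R. Cod E e = Dom E m \<and> f = m \<cdot>\<^bsub>E\<^esub> e) \<and>
     (\<forall>l \<in> L. \<forall>q \<in> R. \<forall>r s. (l, q, r, s) \<in> Arr (arrow_cat E) \<longrightarrow>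
        (\<exists>!d. d \<in> hom E (Cod E l) (Dom E q) \<and> d \<cdot>\<^bsub>E\<^esub> l = r \<and> q \<cdot>\<^bsub>E\<^esub> d = s)))"

definition corresponding_sfs ::
  "('o, 'a) cat \<Rightarrow> ('a, 'a square, 'o, 'a) funct \<Rightarrow> 'a set \<times> 'a set" where
  "corresponding_sfs E F =
     ({f \<in> Arr E. right_factor E F f \<in> identities E},
      {f \<in> Arr E. left_factor E F f \<in> identities E})"

definition associated_ofs ::
  "('o, 'a) cat \<Rightarrow> ('a, 'a square, 'o, 'a) funct \<Rightarrow> 'a set \<times> 'a set" where
  "associated_ofs E F =
     ({f \<in> Arr E. right_factor E F f \<in> Iso E}, {f \<in> Arr E. left_factor E F f \<in> Iso E})"

section \<open>The algebra of a split cofibration\<close>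

text \<open>As for squares, the arrow \<open>(f, v)\<close> from \<open>p = (x, u)\<close> to \<open>q = (y, w)\<close> is encoded as
  \<open>(p, q, f, v)\<close>.\<close>

definition comma_cat ::
  "('eo, 'ea) cat \<Rightarrow> ('bo, 'ba) cat \<Rightarrow> ('eo, 'ea, 'bo, 'ba) funct \<Rightarrow>
   ('eo \<times> 'ba, ('eo \<times> 'ba) \<times> ('eo \<times> 'ba) \<times> 'ea \<times> 'ba) cat" where
  "comma_cat E B P =
     (let O_c = {(x, u). x \<in> Obj E \<and> u \<in> Arr B \<and> Dom B u = fobj P x} in
     \<lparr>Obj = O_c,
      Arr = {((x, u), (y, w), f, v). (x, u) \<in> O_c \<and> (y, w) \<in> O_c \<and> f \<in> hom E x y \<and>
              v \<in> hom B (Cod B u) (Cod B w) \<and> v \<cdot>\<^bsub>B\<^esub> u = w \<cdot>\<^bsub>B\<^esub> farr P f},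
      Dom = (\<lambda>(p, q, f, v). p),
      Cod = (\<lambda>(p, q, f, v). q),
      Idt = (\<lambda>(x, u). ((x, u), (x, u), Idt E x, Idt B (Cod B u))),
      Comp = (\<lambda>(q, r, f', v') (p, q', f, v). (p, r, f' \<cdot>\<^bsub>E\<^esub> f, v' \<cdot>\<^bsub>B\<^esub> v))\<rparr>)"

definition Cod_functor ::
  "('bo, 'ba) cat \<Rightarrow>
   ('eo \<times> 'ba, ('eo \<times> 'ba) \<times> ('eo \<times> 'ba) \<times> 'ea \<times> 'ba, 'bo, 'ba) funct" where
  "Cod_functor B = \<lparr>fobj = (\<lambda>(x, u). Cod B u), farr = (\<lambda>(p, q, f, v). v)\<rparr>"

text \<open>The functor $L^P$. That it is the unique functor with the expected properties is proved
  below, as \<open>L_functor_functor\<close>, \<open>L_functor_over\<close>, \<open>L_functor_delta\<close> and \<open>L_functor_unique\<close>.\<close>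

definition L_functor ::
  "('eo, 'ea) cat \<Rightarrow> ('bo, 'ba) cat \<Rightarrow> ('eo, 'ea, 'bo, 'ba) funct \<Rightarrow> ('eo \<Rightarrow> 'ba \<Rightarrow> 'ea) \<Rightarrow>
   ('eo \<times> 'ba, ('eo \<times> 'ba) \<times> ('eo \<times> 'ba) \<times> 'ea \<times> 'ba, 'eo, 'ea) funct" where
  "L_functor E B P \<delta> =
     \<lparr>fobj = (\<lambda>(x, u). fobj (pushforward E B P \<delta> u) x),
      farr = (\<lambda>((x, u), (y, w), f, v).
         THE l. l \<in> hom E (fobj (pushforward E B P \<delta> u) x) (fobj (pushforward E B P \<delta> w) y) \<and>
           farr P l = v \<and> l \<cdot>\<^bsub>E\<^esub> \<delta> x u = \<delta> y w \<cdot>\<^bsub>E\<^esub> f)\<rparr>"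

definition kappa ::
  "('eo, 'ea) cat \<Rightarrow> ('eo, 'ea, 'bo, 'ba) funct \<Rightarrow>
   ('ea, 'ea square, 'eo \<times> 'ba, ('eo \<times> 'ba) \<times> ('eo \<times> 'ba) \<times> 'ea \<times> 'ba) funct" where
  "kappa E P =
     \<lparr>fobj = (\<lambda>f. (Dom E f, farr P f)),
      farr = (\<lambda>(f, g, r, s). ((Dom E f, farr P f), (Dom E g, farr P g), r, farr P s))\<rparr>"

definition F_algebra ::
  "('eo, 'ea) cat \<Rightarrow> ('bo, 'ba) cat \<Rightarrow> ('eo, 'ea, 'bo, 'ba) funct \<Rightarrow> ('eo \<Rightarrow> 'ba \<Rightarrow> 'ea) \<Rightarrow>
   ('ea, 'ea square, 'eo, 'ea) funct" where
  "F_algebra E B P \<delta> = L_functor E B P \<delta> \<circ>\<^sub>F kappa E P"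

section \<open>Well-definedness of the pushforward and of \<open>L_functor\<close>\<close>

lemma (in category) Comp_props:
  assumes "f \<in> Arr C" "g \<in> Arr C" "Cod C f = Dom C g"
  shows "g \<cdot> f \<in> Arr C" "Dom C (g \<cdot> f) = Dom C f" "Cod C (g \<cdot> f) = Cod C g"
  using Comp_hom[of f "Dom C f" "Cod C f" g "Cod C g"] assms by (auto simp: hom_def)

lemma (in category) Idt_props:
  assumes "x \<in> Obj C"
  shows "Idt C x \<in> Arr C" "Dom C (Idt C x) = x" "Cod C (Idt C x) = x"
  using Idt_hom[OF assms] by (auto simp: hom_def)

lemma (in category) Comp_assoc':
  assumes "f \<in> Arr C" "g \<in> Arr C" "h \<in> Arr C" "Cod C f = Dom C g" "Cod C g = Dom C h"
  shows "(h \<cdot> g) \<cdot> f = h \<cdot> (g \<cdot> f)"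
  using Comp_assoc[of f "Dom C f" "Cod C f" g "Cod C g" h "Cod C h"] assms by (auto simp: hom_def)

lemma (in category) Comp_Idt': "\<lbrakk>f \<in> Arr C; Dom C f = x\<rbrakk> \<Longrightarrow> f \<cdot> Idt C x = f"
  using Comp_Idt[of f "Dom C f" "Cod C f"] by (auto simp: hom_def)

lemma (in category) Idt_Comp': "\<lbrakk>f \<in> Arr C; Cod C f = y\<rbrakk> \<Longrightarrow> Idt C y \<cdot> f = f"
  using Idt_Comp[of f "Dom C f" "Cod C f"] by (auto simp: hom_def)

lemma (in cat_functor) farr_props:
  assumes "f \<in> Arr C"
  shows "farr F f \<in> Arr D" "Dom D (farr F f) = fobj F (Dom C f)" "Cod D (farr F f) = fobj F (Cod C f)"
  using farr_hom[of f "Dom C f" "Cod C f"] assms by (auto simp: hom_def)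

lemma (in cat_functor) farr_Comp':
  assumes "f \<in> Arr C" "g \<in> Arr C" "Cod C f = Dom C g"
  shows "farr F (g \<cdot>\<^bsub>C\<^esub> f) = farr F g \<cdot>\<^bsub>D\<^esub> farr F f"
  using farr_Comp[of f "Dom C f" "Cod C f" g "Cod C g"] assms by (auto simp: hom_def)

lemma (in cat_functor) category_comma_cat: "category (comma_cat C D F)"
  by unfold_locales
    (auto simp: comma_cat_def Let_def hom_def dom.Idt_props cod.Idt_props dom.Comp_props
      cod.Comp_props dom.Comp_Idt' cod.Comp_Idt' dom.Idt_Comp' cod.Idt_Comp' farr_Idt farr_props
      dom.Dom_Obj cod.Cod_Obj dom.Cod_Obj dom.Comp_assoc' cod.Comp_assoc' farr_Comp',
     metis cod.Comp_assoc' farr_props)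

lemma (in category) category_arrow_cat: "category (arrow_cat C)"
  by unfold_locales
    (auto simp: arrow_cat_def hom_def Idt_props Comp_props Comp_Idt' Idt_Comp' Dom_Obj Cod_Obj
      Comp_assoc',
     metis Comp_assoc')

lemma (in cat_functor) category_fibre:
  assumes a: "a \<in> Obj D"
  shows "category (fibre C D F a)"
  by unfold_locales
    (auto simp: fibre_def hom_def dom.Idt_props dom.Comp_props dom.Comp_Idt' dom.Idt_Comp' farr_Idt
      dom.Dom_Obj dom.Cod_Obj dom.Comp_assoc' farr_Comp',
     (metis farr_props(2) cod.Idt_props(2) a),
     (metis farr_props(3) cod.Idt_props(3) a),
     (metis cod.Idt_props cod.Idt_Comp' a))

context cleavage
begin

lemma pushforward_obj [simp]: "fobj (pushforward E B P \<delta> u) x = Cod E (\<delta> x u)"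
  by (simp add: pushforward_def)

lemma delta_props:
  assumes "x \<in> Obj E" "u \<in> Arr B" "Dom B u = fobj P x"
  shows "\<delta> x u \<in> Arr E" "Dom E (\<delta> x u) = x" "farr P (\<delta> x u) = u"
    "Cod E (\<delta> x u) \<in> Obj E" "fobj P (Cod E (\<delta> x u)) = Cod B u"
proof -
  show *: "\<delta> x u \<in> Arr E"
    using cleavage_CoCart[OF assms] by (simp add: CoCart_def)
  show "Dom E (\<delta> x u) = x" "farr P (\<delta> x u) = u" "Cod E (\<delta> x u) \<in> Obj E"
    using cleavage_Dom cleavage_over assms dom.Cod_Obj * by auto
  then show "fobj P (Cod E (\<delta> x u)) = Cod B u"
    using farr_props[OF *] by simp
qed

lemma delta_universal:
  assumes "x \<in> Obj E" "u \<in> Arr B" "Dom B u = fobj P x"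
    and "g \<in> Arr E" "Dom E g = x" "v \<in> hom B (Cod B u) (fobj P (Cod E g))"
    and "farr P g = v \<cdot>\<^bsub>B\<^esub> u"
  shows "\<exists>!h. h \<in> hom E (Cod E (\<delta> x u)) (Cod E g) \<and> h \<cdot>\<^bsub>E\<^esub> \<delta> x u = g \<and> farr P h = v"
  using cleavage_CoCart[OF assms(1-3)] delta_props[OF assms(1-3)] assms(4-) dom.Cod_Obj[OF assms(4)]
  by (simp add: CoCart_def hom_def)

lemma L_functor_ex1:
  assumes "((x, u), (y, w), f, v) \<in> Arr (comma_cat E B P)"
  shows "\<exists>!l. l \<in> hom E (Cod E (\<delta> x u)) (Cod E (\<delta> y w)) \<and> farr P l = v \<and>
      l \<cdot>\<^bsub>E\<^esub> \<delta> x u = \<delta> y w \<cdot>\<^bsub>E\<^esub> f"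
proof -
  from assms have x: "x \<in> Obj E" "u \<in> Arr B" "Dom B u = fobj P x"
    and y: "y \<in> Obj E" "w \<in> Arr B" "Dom B w = fobj P y"
    and f: "f \<in> Arr E" "Dom E f = x" "Cod E f = y" and v: "v \<in> hom B (Cod B u) (Cod B w)"
    and eq: "v \<cdot>\<^bsub>B\<^esub> u = w \<cdot>\<^bsub>B\<^esub> farr P f"
    by (auto simp: comma_cat_def Let_def hom_def)
  note d = delta_props[OF x] delta_props[OF y]
  have g: "\<delta> y w \<cdot>\<^bsub>E\<^esub> f \<in> Arr E" "Dom E (\<delta> y w \<cdot>\<^bsub>E\<^esub> f) = x"
    "Cod E (\<delta> y w \<cdot>\<^bsub>E\<^esub> f) = Cod E (\<delta> y w)"
    using dom.Comp_props[of f "\<delta> y w"] f d by auto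
  have "farr P (\<delta> y w \<cdot>\<^bsub>E\<^esub> f) = v \<cdot>\<^bsub>B\<^esub> u"
    using farr_Comp'[of f "\<delta> y w"] f d eq by simp
  then have "\<exists>!h. h \<in> hom E (Cod E (\<delta> x u)) (Cod E (\<delta> y w)) \<and>
      h \<cdot>\<^bsub>E\<^esub> \<delta> x u = \<delta> y w \<cdot>\<^bsub>E\<^esub> f \<and> farr P h = v"
    using delta_universal[OF x g(1,2), of v] g d v by simp
  then show ?thesis
    by (simp add: conj_commute)
qed

lemma L_functor_arr:
  assumes "((x, u), (y, w), f, v) \<in> Arr (comma_cat E B P)"
  shows "farr (L_functor E B P \<delta>) ((x, u), (y, w), f, v) \<in>
      hom E (Cod E (\<delta> x u)) (Cod E (\<delta> y w)) \<and>
      farr P (farr (L_functor E B P \<delta>) ((x, u), (y, w), f, v)) = v \<and>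
      farr (L_functor E B P \<delta>) ((x, u), (y, w), f, v) \<cdot>\<^bsub>E\<^esub> \<delta> x u = \<delta> y w \<cdot>\<^bsub>E\<^esub> f"
  using theI'[OF L_functor_ex1[OF assms]] by (simp add: L_functor_def)

lemma L_functor_eqI:
  assumes "((x, u), (y, w), f, v) \<in> Arr (comma_cat E B P)"
    and "l \<in> hom E (Cod E (\<delta> x u)) (Cod E (\<delta> y w))" "farr P l = v"
    and "l \<cdot>\<^bsub>E\<^esub> \<delta> x u = \<delta> y w \<cdot>\<^bsub>E\<^esub> f"
  shows "farr (L_functor E B P \<delta>) ((x, u), (y, w), f, v) = l"
  using L_functor_ex1[OF assms(1)] L_functor_arr[OF assms(1)] assms(2-) by blast

theorem L_functor_functor: "cat_functor (comma_cat E B P) E (L_functor E B P \<delta>)"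
proof -
  interpret K: category "comma_cat E B P" by (rule category_comma_cat)
  let ?L = "L_functor E B P \<delta>"
  have obj: "fobj ?L (x, u) = Cod E (\<delta> x u)" for x u
    by (simp add: L_functor_def)
  show ?thesis
  proof
    fix p assume "p \<in> Obj (comma_cat E B P)"
    then obtain x u where p: "p = (x, u)" and x: "x \<in> Obj E" "u \<in> Arr B" "Dom B u = fobj P x"
      by (auto simp: comma_cat_def Let_def)
    note d = delta_props[OF x]
    show "fobj ?L p \<in> Obj E"
      using d by (simp add: p obj)
    have a: "((x, u), (x, u), Idt E x, Idt B (Cod B u)) \<in> Arr (comma_cat E B P)"
      using K.Idt_props(1)[OF \<open>p \<in> _\<close>] by (simp add: p comma_cat_def)
    have "farr ?L ((x, u), (x, u), Idt E x, Idt B (Cod B u)) = Idt E (Cod E (\<delta> x u))"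
      by (rule L_functor_eqI[OF a])
        (use d dom.Idt_hom dom.Idt_Comp'[of "\<delta> x u"] dom.Comp_Idt'[of "\<delta> x u"] farr_Idt in auto)
    then show "farr ?L (Idt (comma_cat E B P) p) = Idt E (fobj ?L p)"
      by (simp add: p obj) (simp add: comma_cat_def)
  next
    fix c p q assume "c \<in> hom (comma_cat E B P) p q"
    moreover obtain x u y w x' u' y' w' f v where c: "c = ((x', u'), (y', w'), f, v)"
      and pq: "p = (x, u)" "q = (y, w)"
      by (metis surj_pair)
    ultimately have "x' = x" "u' = u" "y' = y" "w' = w" "c \<in> Arr (comma_cat E B P)"
      by (auto simp: hom_def comma_cat_def)
    then show "farr ?L c \<in> hom E (fobj ?L p) (fobj ?L q)"
      using L_functor_arr by (simp add: c pq obj)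
  next
    fix c c' p q r
    assume *: "c \<in> hom (comma_cat E B P) p q" "c' \<in> hom (comma_cat E B P) q r"
    obtain x u y w z t where pqr: "p = (x, u)" "q = (y, w)" "r = (z, t)"
      by (metis surj_pair)
    from * obtain f v f' v' where c: "c = ((x, u), (y, w), f, v)" "c' = ((y, w), (z, t), f', v')"
      unfolding pqr hom_def comma_cat_def by auto
    have arr: "c \<in> Arr (comma_cat E B P)" "c' \<in> Arr (comma_cat E B P)"
      using * by (auto simp: hom_def)
    have comp: "c' \<cdot>\<^bsub>comma_cat E B P\<^esub> c = ((x, u), (z, t), f' \<cdot>\<^bsub>E\<^esub> f, v' \<cdot>\<^bsub>B\<^esub> v)"
      by (simp add: c comma_cat_def)
    have arr3: "((x, u), (z, t), f' \<cdot>\<^bsub>E\<^esub> f, v' \<cdot>\<^bsub>B\<^esub> v) \<in> Arr (comma_cat E B P)"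
      using K.Comp_hom[OF *] by (simp add: comp hom_def)
    note l = L_functor_arr[OF arr(1)[unfolded c]] and l' = L_functor_arr[OF arr(2)[unfolded c]]
    have x: "x \<in> Obj E" "u \<in> Arr B" "Dom B u = fobj P x"
      and y: "y \<in> Obj E" "w \<in> Arr B" "Dom B w = fobj P y"
      and z: "z \<in> Obj E" "t \<in> Arr B" "Dom B t = fobj P z"
      and f: "f \<in> Arr E" "Dom E f = x" "Cod E f = y" "f' \<in> Arr E" "Dom E f' = y" "Cod E f' = z"
      using arr by (auto simp: c comma_cat_def Let_def hom_def)
    note d = delta_props[OF x] delta_props[OF y] delta_props[OF z]
    have "farr ?L ((x, u), (z, t), f' \<cdot>\<^bsub>E\<^esub> f, v' \<cdot>\<^bsub>B\<^esub> v) = farr ?L c' \<cdot>\<^bsub>E\<^esub> farr ?L c"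
    proof (rule L_functor_eqI[OF arr3])
      show "farr ?L c' \<cdot>\<^bsub>E\<^esub> farr ?L c \<in> hom E (Cod E (\<delta> x u)) (Cod E (\<delta> z t))"
        using dom.Comp_hom l l' by (auto simp: c)
      show "farr P (farr ?L c' \<cdot>\<^bsub>E\<^esub> farr ?L c) = v' \<cdot>\<^bsub>B\<^esub> v"
        using farr_Comp l l' unfolding c by metis
      have "(farr ?L c' \<cdot>\<^bsub>E\<^esub> farr ?L c) \<cdot>\<^bsub>E\<^esub> \<delta> x u = farr ?L c' \<cdot>\<^bsub>E\<^esub> (farr ?L c \<cdot>\<^bsub>E\<^esub> \<delta> x u)"
        using l l' d by (intro dom.Comp_assoc') (auto simp: hom_def c)
      also have "\<dots> = farr ?L c' \<cdot>\<^bsub>E\<^esub> (\<delta> y w \<cdot>\<^bsub>E\<^esub> f)"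
        using l by (simp add: c)
      also have "\<dots> = (farr ?L c' \<cdot>\<^bsub>E\<^esub> \<delta> y w) \<cdot>\<^bsub>E\<^esub> f"
        using l' d f by (intro dom.Comp_assoc'[symmetric]) (auto simp: hom_def c)
      also have "\<dots> = (\<delta> z t \<cdot>\<^bsub>E\<^esub> f') \<cdot>\<^bsub>E\<^esub> f"
        using l' by (simp add: c)
      also have "\<dots> = \<delta> z t \<cdot>\<^bsub>E\<^esub> (f' \<cdot>\<^bsub>E\<^esub> f)"
        using d f by (intro dom.Comp_assoc') auto
      finally show "(farr ?L c' \<cdot>\<^bsub>E\<^esub> farr ?L c) \<cdot>\<^bsub>E\<^esub> \<delta> x u = \<delta> z t \<cdot>\<^bsub>E\<^esub> (f' \<cdot>\<^bsub>E\<^esub> f)" .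
    qed
    then show "farr ?L (c' \<cdot>\<^bsub>comma_cat E B P\<^esub> c) = farr ?L c' \<cdot>\<^bsub>E\<^esub> farr ?L c"
      by (simp add: comp)
  qed
qed

theorem L_functor_over:
  "functor_eq (comma_cat E B P) (P \<circ>\<^sub>F L_functor E B P \<delta>) (Cod_functor B)"
proof -
  have "farr P (farr (L_functor E B P \<delta>) c) = farr (Cod_functor B) c"
    if "c \<in> Arr (comma_cat E B P)" for c
    using that L_functor_arr by (cases c) (auto simp: Cod_functor_def)
  then show ?thesis
    by (auto simp: functor_eq_def comp_functor_def)
      (auto simp: Cod_functor_def L_functor_def comma_cat_def Let_def delta_props)
qed

theorem L_functor_delta:
  assumes "((x, u), (y, w), f, v) \<in> Arr (comma_cat E B P)"
  shows "farr (L_functor E B P \<delta>) ((x, u), (y, w), f, v) \<cdot>\<^bsub>E\<^esub> \<delta> x u = \<delta> y w \<cdot>\<^bsub>E\<^esub> f"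
  using L_functor_arr[OF assms] by simp

theorem L_functor_unique:
  assumes K: "cat_functor (comma_cat E B P) E K"
    and obj: "\<And>x u. (x, u) \<in> Obj (comma_cat E B P) \<Longrightarrow>
      fobj K (x, u) = fobj (pushforward E B P \<delta> u) x"
    and over: "functor_eq (comma_cat E B P) (P \<circ>\<^sub>F K) (Cod_functor B)"
    and delta: "\<And>x u y w f v. ((x, u), (y, w), f, v) \<in> Arr (comma_cat E B P) \<Longrightarrow>
      farr K ((x, u), (y, w), f, v) \<cdot>\<^bsub>E\<^esub> \<delta> x u = \<delta> y w \<cdot>\<^bsub>E\<^esub> f"
  shows "functor_eq (comma_cat E B P) K (L_functor E B P \<delta>)"
proof -
  interpret K: cat_functor "comma_cat E B P" E K by (rule K)
  have "farr (L_functor E B P \<delta>) c = farr K c" if c: "c \<in> Arr (comma_cat E B P)" for c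
  proof -
    obtain x u y w f v where c': "c = ((x, u), (y, w), f, v)"
      by (metis surj_pair)
    have o: "(x, u) \<in> Obj (comma_cat E B P)" "(y, w) \<in> Obj (comma_cat E B P)"
      using c by (auto simp: c' comma_cat_def Let_def)
    have "Dom (comma_cat E B P) c = (x, u)" "Cod (comma_cat E B P) c = (y, w)"
      by (auto simp: c' comma_cat_def)
    then have "farr K c \<in> hom E (Cod E (\<delta> x u)) (Cod E (\<delta> y w))"
      using K.farr_props[OF c] obj[OF o(1)] obj[OF o(2)] by (simp add: hom_def)
    moreover have "farr P (farr K c) = v"
      using over c by (auto simp: functor_eq_def comp_functor_def Cod_functor_def c')
    ultimately show ?thesis
      using L_functor_eqI delta c unfolding c' by blast
  qed
  then show ?thesis
    using obj by (auto simp: functor_eq_def L_functor_def)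
qed

theorem pushforward_functor:
  assumes "u \<in> hom B a b"
  shows "cat_functor (fibre E B P a) (fibre E B P b) (pushforward E B P \<delta> u)"
proof -
  have u: "u \<in> Arr B" "Dom B u = a" "Cod B u = b" and a: "a \<in> Obj B" and b: "b \<in> Obj B"
    using assms cod.Dom_Obj cod.Cod_Obj by (auto simp: hom_def)
  interpret A: category "fibre E B P a" by (rule category_fibre[OF a])
  interpret B: category "fibre E B P b" by (rule category_fibre[OF b])
  interpret L: cat_functor "comma_cat E B P" E "L_functor E B P \<delta>" by (rule L_functor_functor)
  let ?U = "pushforward E B P \<delta> u" and ?K = "comma_cat E B P"
  have L_obj: "fobj (L_functor E B P \<delta>) (x, w) = Cod E (\<delta> x w)" for x w
    by (simp add: L_functor_def)
  have *: "((Dom E f, u), (Cod E f, u), f, Idt B b) \<in> Arr ?K \<and>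
      farr ?U f = farr (L_functor E B P \<delta>) ((Dom E f, u), (Cod E f, u), f, Idt B b)"
    if "f \<in> hom (fibre E B P a) x y" for f x y
  proof -
    have f: "f \<in> Arr E" "farr P f = Idt B a" "Dom E f = x" "Cod E f = y"
      "x \<in> Obj E" "y \<in> Obj E" "fobj P x = a" "fobj P y = a"
      using that A.Dom_Obj[of f] A.Cod_Obj[of f] by (auto simp: hom_def fibre_def)
    have arr: "((x, u), (y, u), f, Idt B b) \<in> Arr ?K"
      using f u b cod.Comp_Idt'[of u] cod.Idt_Comp'[of u] cod.Idt_hom
      by (auto simp: comma_cat_def Let_def hom_def)
    have over: "k \<in> Vert E B P \<longleftrightarrow> farr P k = Idt B b"
      if "k \<in> hom E (Cod E (\<delta> x u)) (Cod E (\<delta> y u))" for k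
      using that delta_props[of x u] f u b farr_props[of k] cod.Idt_props
      by (auto simp: Vert_def identities_def hom_def)
    have "farr ?U f = (THE k. k \<in> hom E (Cod E (\<delta> x u)) (Cod E (\<delta> y u)) \<and>
        farr P k = Idt B b \<and> k \<cdot>\<^bsub>E\<^esub> \<delta> x u = \<delta> y u \<cdot>\<^bsub>E\<^esub> f)"
      unfolding pushforward_def using f over by (auto intro!: arg_cong[where f = The])
    then show ?thesis
      using arr f by (simp add: L_functor_def)
  qed
  have fib: "x \<in> Obj E \<and> u \<in> Arr B \<and> Dom B u = fobj P x" if "x \<in> Obj (fibre E B P a)" for x
    using that u by (auto simp: fibre_def)
  show ?thesis
  proof
    fix x assume x: "x \<in> Obj (fibre E B P a)"
    show "fobj ?U x \<in> Obj (fibre E B P b)"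
      using delta_props fib[OF x] u by (auto simp: fibre_def)
    have "Idt E x \<in> hom (fibre E B P a) x x"
      using A.Idt_hom[OF x] by (simp add: fibre_def)
    moreover have "(x, u) \<in> Obj ?K"
      using fib[OF x] by (simp add: comma_cat_def)
    ultimately show "farr ?U (Idt (fibre E B P a) x) = Idt (fibre E B P b) (fobj ?U x)"
      using *[of "Idt E x" x x] L.farr_Idt[of "(x, u)"] fib[OF x] dom.Idt_props[of x] u
      by (simp add: fibre_def L_obj) (simp add: comma_cat_def)
  next
    fix f x y assume f: "f \<in> hom (fibre E B P a) x y"
    then have "Dom E f = x" "Cod E f = y"
      by (auto simp: hom_def fibre_def)
    then show "farr ?U f \<in> hom (fibre E B P b) (fobj ?U x) (fobj ?U y)"
      using *[OF f] L_functor_arr[of x u y u f "Idt B b"] by (auto simp: hom_def fibre_def)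
  next
    fix f g x y z
    assume f: "f \<in> hom (fibre E B P a) x y" and g: "g \<in> hom (fibre E B P a) y z"
    let ?f = "((x, u), (y, u), f, Idt B b)" and ?g = "((y, u), (z, u), g, Idt B b)"
    have fg: "f \<in> hom E x y" "g \<in> hom E y z"
      using f g by (auto simp: hom_def fibre_def)
    have gf: "g \<cdot>\<^bsub>E\<^esub> f \<in> hom (fibre E B P a) x z" "g \<cdot>\<^bsub>E\<^esub> f \<in> hom E x z"
      using A.Comp_hom[OF f g] dom.Comp_hom[OF fg] by (auto simp: fibre_def)
    have "?f \<in> hom ?K (x, u) (y, u)" "?g \<in> hom ?K (y, u) (z, u)"
      using *[OF f] *[OF g] fg by (auto simp: hom_def) (auto simp: comma_cat_def)
    from L.farr_Comp[OF this]
    show "farr ?U (g \<cdot>\<^bsub>fibre E B P a\<^esub> f) = farr ?U g \<cdot>\<^bsub>fibre E B P b\<^esub> farr ?U f"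
      using *[OF f] *[OF g] *[OF gf(1)] fg gf(2) cod.Idt_Comp'[of "Idt B b"] cod.Idt_props[OF b]
      by (simp add: fibre_def hom_def) (simp add: comma_cat_def)
  qed
qed

end

end

theory Submission
  imports Defs
begin

text \<open>The algebra sends \<open>f : x \<rightarrow> y\<close> to the factorization of \<open>f\<close> through the chosen cocartesian lift
  of \<open>P f\<close>: the left factor is $\delta^x_{Pf}$, and the right factor is the vertical arrow that the
  universal property of $\delta^x_{Pf}$ provides. Every equation between arrows out of a
  cocartesian \<open>e\<close> is checked after composition with \<open>e\<close> and after applying \<open>P\<close>; the splitting turns
  the comparison of iterated lifts into equalities. For the orthogonal system, the right factor of
  \<open>f\<close> compares two cocartesian lifts when \<open>f\<close> is cocartesian, and the left factor is a
  cocartesian lift of an isomorphism when \<open>P f\<close> is invertible.\<close>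

section \<open>Isomorphisms\<close>

context category
begin

lemma IsoE:
  assumes "f \<in> Iso C"
  obtains g where "f \<in> Arr C" "g \<in> Arr C" "Dom C g = Cod C f" "Cod C g = Dom C f"
    "g \<cdot> f = Idt C (Dom C f)" "f \<cdot> g = Idt C (Cod C f)"
  using assms by (auto simp: Iso_def hom_def)

lemma IsoI:
  assumes "f \<in> Arr C" "g \<in> Arr C" "Dom C g = Cod C f" "Cod C g = Dom C f"
    "g \<cdot> f = Idt C (Dom C f)" "f \<cdot> g = Idt C (Cod C f)"
  shows "f \<in> Iso C"
  using assms by (auto simp: Iso_def hom_def)

lemma Idt_Iso: "x \<in> Obj C \<Longrightarrow> Idt C x \<in> Iso C"
  by (rule IsoI[where g = "Idt C x"]) (auto simp: Idt_props Idt_Comp')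

lemma identities_Iso: "identities C \<subseteq> Iso C"
  by (auto simp: identities_def Idt_Iso)

lemma cancel_left_inverse:
  assumes "f \<in> Arr C" "h \<in> Arr C" "Cod C f = Dom C h"
    and "k \<in> Arr C" "Dom C k = Cod C h" "k \<cdot> h = Idt C (Dom C h)"
  shows "k \<cdot> (h \<cdot> f) = f"
  using assms Comp_assoc'[of f h k] Idt_Comp' by simp

lemma cancel_right_inverse:
  assumes "f \<in> Arr C" "h \<in> Arr C" "Dom C f = Cod C h"
    and "k \<in> Arr C" "Cod C k = Dom C h" "h \<cdot> k = Idt C (Cod C h)"
  shows "(f \<cdot> h) \<cdot> k = f"
  using assms Comp_assoc'[of k h f] Comp_Idt' by simp

lemma Iso_Comp:
  assumes f: "f \<in> Iso C" and g: "g \<in> Iso C" and fg: "Cod C f = Dom C g"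
  shows "g \<cdot> f \<in> Iso C"
proof -
  obtain f' where f': "f \<in> Arr C" "f' \<in> Arr C" "Dom C f' = Cod C f" "Cod C f' = Dom C f"
    "f' \<cdot> f = Idt C (Dom C f)" "f \<cdot> f' = Idt C (Cod C f)"
    using f by (rule IsoE)
  obtain g' where g': "g \<in> Arr C" "g' \<in> Arr C" "Dom C g' = Cod C g" "Cod C g' = Dom C g"
    "g' \<cdot> g = Idt C (Dom C g)" "g \<cdot> g' = Idt C (Cod C g)"
    using g by (rule IsoE)
  show ?thesis
  proof (rule IsoI[where g = "f' \<cdot> g'"])
    show "(f' \<cdot> g') \<cdot> (g \<cdot> f) = Idt C (Dom C (g \<cdot> f))"
      using f' g' fg cancel_left_inverse[of f g g'] Comp_assoc'[of "g \<cdot> f" g' f']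
      by (simp add: Comp_props)
    show "(g \<cdot> f) \<cdot> (f' \<cdot> g') = Idt C (Cod C (g \<cdot> f))"
      using f' g' fg cancel_left_inverse[of g' f' f] Comp_assoc'[of "f' \<cdot> g'" f g]
      by (simp add: Comp_props)
  qed (use f' g' fg in \<open>auto simp: Comp_props\<close>)
qed

end

lemma (in cat_functor) farr_Iso:
  assumes "f \<in> Iso C"
  shows "farr F f \<in> Iso D"
proof -
  obtain g where g: "f \<in> Arr C" "g \<in> Arr C" "Dom C g = Cod C f" "Cod C g = Dom C f"
    "g \<cdot>\<^bsub>C\<^esub> f = Idt C (Dom C f)" "f \<cdot>\<^bsub>C\<^esub> g = Idt C (Cod C f)"
    using assms by (rule dom.IsoE)
  then show ?thesis
    using farr_Comp'[of f g] farr_Comp'[of g f]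
    by (intro cod.IsoI[where g = "farr F g"])
      (auto simp: farr_props farr_Idt dom.Dom_Obj dom.Cod_Obj)
qed

lemma cat_functor_comp:
  assumes "cat_functor C D F" "cat_functor D A G"
  shows "cat_functor C A (G \<circ>\<^sub>F F)"
proof -
  interpret F: cat_functor C D F by (rule assms)
  interpret G: cat_functor D A G by (rule assms)
  show ?thesis
  proof
    fix f g x y z
    assume "f \<in> hom C x y" "g \<in> hom C y z"
    then show "farr (G \<circ>\<^sub>F F) (g \<cdot>\<^bsub>C\<^esub> f) = farr (G \<circ>\<^sub>F F) g \<cdot>\<^bsub>A\<^esub> farr (G \<circ>\<^sub>F F) f"
      using F.farr_Comp G.farr_Comp[OF F.farr_hom F.farr_hom] by (simp add: comp_functor_def)
  qed (auto simp: comp_functor_def F.fobj_Obj G.fobj_Obj F.farr_Idt G.farr_Idt F.farr_hom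
        intro!: G.farr_hom)
qed

section \<open>Cocartesian arrows\<close>

context cat_functor
begin

lemma CoCart_Arr: "e \<in> CoCart C D F \<Longrightarrow> e \<in> Arr C"
  by (simp add: CoCart_def)

lemma CoCart_ex1:
  assumes "e \<in> CoCart C D F" and "g \<in> Arr C" "Dom C g = Dom C e"
    and "v \<in> Arr D" "Dom D v = fobj F (Cod C e)" "Cod D v = fobj F (Cod C g)"
    and "farr F g = v \<cdot>\<^bsub>D\<^esub> farr F e"
  shows "\<exists>!h. h \<in> hom C (Cod C e) (Cod C g) \<and> h \<cdot>\<^bsub>C\<^esub> e = g \<and> farr F h = v"
  using assms dom.Cod_Obj[OF assms(2)] by (simp add: CoCart_def hom_def)

lemma CoCartE:
  assumes "e \<in> CoCart C D F" and "g \<in> Arr C" "Dom C g = Dom C e"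
    and "v \<in> Arr D" "Dom D v = fobj F (Cod C e)" "Cod D v = fobj F (Cod C g)"
    and "farr F g = v \<cdot>\<^bsub>D\<^esub> farr F e"
  obtains h where "h \<in> Arr C" "Dom C h = Cod C e" "Cod C h = Cod C g" "h \<cdot>\<^bsub>C\<^esub> e = g" "farr F h = v"
  using CoCart_ex1[OF assms] by (auto simp: hom_def)

text \<open>The uniqueness half of \<open>CoCart_ex1\<close>, for \<open>g = k \<cdot> e\<close> and
  \<open>v\<close> the image of \<open>k\<close>: arrows out of \<open>Cod C e\<close> with a common
  codomain are tested by composition with \<open>e\<close> and by their images under
  \<open>F\<close>.\<close>

lemma CoCart_eqI:
  assumes e: "e \<in> CoCart C D F"
    and h: "h \<in> Arr C" "Dom C h = Cod C e" and k: "k \<in> Arr C" "Dom C k = Cod C e"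
    and cod: "Cod C h = Cod C k" and eq: "h \<cdot>\<^bsub>C\<^esub> e = k \<cdot>\<^bsub>C\<^esub> e" and over: "farr F h = farr F k"
  shows "h = k"
proof -
  note e' = CoCart_Arr[OF e]
  have "\<exists>!l. l \<in> hom C (Cod C e) (Cod C (k \<cdot>\<^bsub>C\<^esub> e)) \<and> l \<cdot>\<^bsub>C\<^esub> e = k \<cdot>\<^bsub>C\<^esub> e \<and> farr F l = farr F k"
    using e' k by (intro CoCart_ex1[OF e]) (auto simp: dom.Comp_props farr_props farr_Comp')
  moreover have "h \<in> hom C (Cod C e) (Cod C (k \<cdot>\<^bsub>C\<^esub> e))" "k \<in> hom C (Cod C e) (Cod C (k \<cdot>\<^bsub>C\<^esub> e))"
    using e' h k cod by (auto simp: hom_def dom.Comp_props)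
  ultimately show ?thesis
    using eq over by blast
qed

text \<open>Uniqueness of extensions is required only as cancellation: two extensions of the same
  \<open>g\<close> over the same \<open>v\<close> satisfy the premises of \<open>eq\<close>.\<close>

lemma CoCartI:
  assumes "e \<in> Arr C"
    and ex: "\<And>g v. \<lbrakk>g \<in> Arr C; Dom C g = Dom C e; v \<in> Arr D; Dom D v = fobj F (Cod C e);
        Cod D v = fobj F (Cod C g); farr F g = v \<cdot>\<^bsub>D\<^esub> farr F e\<rbrakk> \<Longrightarrow>
      \<exists>h. h \<in> Arr C \<and> Dom C h = Cod C e \<and> Cod C h = Cod C g \<and> h \<cdot>\<^bsub>C\<^esub> e = g \<and> farr F h = v"
    and eq: "\<And>h k. \<lbrakk>h \<in> Arr C; k \<in> Arr C; Dom C h = Cod C e; Dom C k = Cod C e; Cod C h = Cod C k;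
        h \<cdot>\<^bsub>C\<^esub> e = k \<cdot>\<^bsub>C\<^esub> e; farr F h = farr F k\<rbrakk> \<Longrightarrow> h = k"
  shows "e \<in> CoCart C D F"
proof -
  have "\<exists>!h. h \<in> hom C (Cod C e) z \<and> h \<cdot>\<^bsub>C\<^esub> e = g \<and> farr F h = v"
    if "g \<in> hom C (Dom C e) z" "v \<in> hom D (fobj F (Cod C e)) (fobj F z)"
      "farr F g = v \<cdot>\<^bsub>D\<^esub> farr F e" for z g v
  proof (rule ex_ex1I)
    show "\<exists>h. h \<in> hom C (Cod C e) z \<and> h \<cdot>\<^bsub>C\<^esub> e = g \<and> farr F h = v"
      using ex[of g v] that by (auto simp: hom_def)
  qed (auto simp: hom_def intro: eq)
  with \<open>e \<in> Arr C\<close> show ?thesis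
    by (simp add: CoCart_def)
qed

text \<open>With \<open>i\<close> inverse to \<open>e\<close>, the only candidate for the extension
  of \<open>g\<close> is \<open>g \<cdot> i\<close>, and it lies over \<open>v\<close> because the
  image of \<open>i\<close> cancels that of \<open>e\<close>.\<close>

lemma Iso_CoCart:
  assumes "e \<in> Iso C"
  shows "e \<in> CoCart C D F"
proof -
  obtain i where e: "e \<in> Arr C" and i: "i \<in> Arr C" "Dom C i = Cod C e" "Cod C i = Dom C e"
    "i \<cdot>\<^bsub>C\<^esub> e = Idt C (Dom C e)" "e \<cdot>\<^bsub>C\<^esub> i = Idt C (Cod C e)"
    using assms by (rule dom.IsoE)
  show ?thesis
  proof (rule CoCartI[OF e])
    fix g v
    assume g: "g \<in> Arr C" "Dom C g = Dom C e"
      and v: "v \<in> Arr D" "Dom D v = fobj F (Cod C e)" "farr F g = v \<cdot>\<^bsub>D\<^esub> farr F e"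
    have "farr F e \<cdot>\<^bsub>D\<^esub> farr F i = Idt D (fobj F (Cod C e))"
      using farr_Comp'[of i e] e i by (simp add: farr_Idt dom.Cod_Obj)
    then have "farr F (g \<cdot>\<^bsub>C\<^esub> i) = v"
      using e i g v cod.cancel_right_inverse[of v "farr F e" "farr F i"]
      by (simp add: farr_Comp' farr_props)
    then show "\<exists>h. h \<in> Arr C \<and> Dom C h = Cod C e \<and> Cod C h = Cod C g \<and> h \<cdot>\<^bsub>C\<^esub> e = g \<and> farr F h = v"
      using e i g dom.cancel_right_inverse[of g i e]
      by (intro exI[where x = "g \<cdot>\<^bsub>C\<^esub> i"]) (auto simp: dom.Comp_props)
  next
    fix h k
    assume "h \<in> Arr C" "k \<in> Arr C" "Dom C h = Cod C e" "Dom C k = Cod C e"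
      "h \<cdot>\<^bsub>C\<^esub> e = k \<cdot>\<^bsub>C\<^esub> e"
    then show "h = k"
      using dom.cancel_right_inverse[of _ e i] e i by metis
  qed
qed

text \<open>Extensions are found in two stages, first along \<open>e\<close> and then along
  \<open>d\<close>; uniqueness cancels \<open>e\<close> and then \<open>d\<close>.\<close>

lemma CoCart_Comp:
  assumes e: "e \<in> CoCart C D F" and d: "d \<in> CoCart C D F" and ed: "Cod C e = Dom C d"
  shows "d \<cdot>\<^bsub>C\<^esub> e \<in> CoCart C D F"
proof -
  note arr = CoCart_Arr[OF e] CoCart_Arr[OF d]
  note de = dom.Comp_props[OF arr ed]
  show ?thesis
  proof (rule CoCartI[OF de(1)])
    fix g v
    assume g: "g \<in> Arr C" "Dom C g = Dom C (d \<cdot>\<^bsub>C\<^esub> e)"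
      and v: "v \<in> Arr D" "Dom D v = fobj F (Cod C (d \<cdot>\<^bsub>C\<^esub> e))" "Cod D v = fobj F (Cod C g)"
      and eq: "farr F g = v \<cdot>\<^bsub>D\<^esub> farr F (d \<cdot>\<^bsub>C\<^esub> e)"
    have "(v \<cdot>\<^bsub>D\<^esub> farr F d) \<cdot>\<^bsub>D\<^esub> farr F e = v \<cdot>\<^bsub>D\<^esub> (farr F d \<cdot>\<^bsub>D\<^esub> farr F e)"
      using arr ed v de by (intro cod.Comp_assoc') (simp_all add: farr_props)
    then have "farr F g = (v \<cdot>\<^bsub>D\<^esub> farr F d) \<cdot>\<^bsub>D\<^esub> farr F e"
      using eq farr_Comp'[OF arr ed] by simp
    \<comment> \<open>The intermediate extension has to lie over \<open>v\<close> composed with the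
      image of \<open>d\<close>, so that \<open>d\<close> can extend it further over
      \<open>v\<close>.\<close>
    then obtain h where h: "h \<in> Arr C" "Dom C h = Cod C e" "Cod C h = Cod C g" "h \<cdot>\<^bsub>C\<^esub> e = g"
      "farr F h = v \<cdot>\<^bsub>D\<^esub> farr F d"
      using CoCartE[OF e, of g "v \<cdot>\<^bsub>D\<^esub> farr F d"] g v arr ed de by (auto simp: farr_props cod.Comp_props)
    obtain k where k: "k \<in> Arr C" "Dom C k = Cod C d" "Cod C k = Cod C h" "k \<cdot>\<^bsub>C\<^esub> d = h" "farr F k = v"
      using CoCartE[OF d, of h v] h v de ed by auto
    show "\<exists>h. h \<in> Arr C \<and> Dom C h = Cod C (d \<cdot>\<^bsub>C\<^esub> e) \<and> Cod C h = Cod C g \<and>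
        h \<cdot>\<^bsub>C\<^esub> (d \<cdot>\<^bsub>C\<^esub> e) = g \<and> farr F h = v"
      using h k de ed arr dom.Comp_assoc'[of e d k] by auto
  next
    fix h k
    assume *: "h \<in> Arr C" "k \<in> Arr C" "Dom C h = Cod C (d \<cdot>\<^bsub>C\<^esub> e)" "Dom C k = Cod C (d \<cdot>\<^bsub>C\<^esub> e)"
      "Cod C h = Cod C k" "h \<cdot>\<^bsub>C\<^esub> (d \<cdot>\<^bsub>C\<^esub> e) = k \<cdot>\<^bsub>C\<^esub> (d \<cdot>\<^bsub>C\<^esub> e)" "farr F h = farr F k"
    then have "(h \<cdot>\<^bsub>C\<^esub> d) \<cdot>\<^bsub>C\<^esub> e = (k \<cdot>\<^bsub>C\<^esub> d) \<cdot>\<^bsub>C\<^esub> e"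
      using arr ed de dom.Comp_assoc'[of e d h] dom.Comp_assoc'[of e d k] by simp
    then have "h \<cdot>\<^bsub>C\<^esub> d = k \<cdot>\<^bsub>C\<^esub> d"
      using * arr ed de by - (rule CoCart_eqI[OF e];
        auto simp: dom.Comp_props farr_Comp')
    then show "h = k"
      using * arr de by - (rule CoCart_eqI[OF d]; auto)
  qed
qed

text \<open>Extending the identity of \<open>Dom C e\<close> over the inverse \<open>v\<close>
  yields a left inverse \<open>h\<close>. It is also a right inverse, since
  \<open>e \<cdot> h\<close> and the identity agree after composition with \<open>e\<close> and both
  lie over an identity.\<close>

lemma CoCart_over_Iso:
  assumes e: "e \<in> CoCart C D F" and iso: "farr F e \<in> Iso D"
  shows "e \<in> Iso C"
proof -
  note e' = CoCart_Arr[OF e]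
  note obj = dom.Dom_Obj[OF e'] dom.Cod_Obj[OF e']
  obtain v where v: "v \<in> Arr D" "Dom D v = fobj F (Cod C e)" "Cod D v = fobj F (Dom C e)"
    "v \<cdot>\<^bsub>D\<^esub> farr F e = Idt D (fobj F (Dom C e))" "farr F e \<cdot>\<^bsub>D\<^esub> v = Idt D (fobj F (Cod C e))"
    using iso e' by (elim cod.IsoE) (auto simp: farr_props)
  obtain h where h: "h \<in> Arr C" "Dom C h = Cod C e" "Cod C h = Dom C e"
    "h \<cdot>\<^bsub>C\<^esub> e = Idt C (Dom C e)" "farr F h = v"
    using CoCartE[OF e, of "Idt C (Dom C e)" v] v obj by (auto simp: dom.Idt_props farr_Idt)
  have "e \<cdot>\<^bsub>C\<^esub> h = Idt C (Cod C e)"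
    using e' h v obj dom.Comp_assoc'[of e h e] dom.Idt_Comp'[OF e'] dom.Comp_Idt'[OF e']
    by - (rule CoCart_eqI[OF e];
        auto simp: dom.Comp_props dom.Idt_props farr_Comp' farr_Idt)
  then show ?thesis
    using e' h by (intro dom.IsoI[where g = h]) auto
qed

text \<open>Here \<open>e\<close> and \<open>m \<cdot> e\<close> are cocartesian over the same
  arrow, so \<open>e\<close> extends along \<open>m \<cdot> e\<close> to a vertical
  \<open>n\<close>. Testing against \<open>e\<close> gives one inverse law for \<open>m\<close> and
  \<open>n\<close>, testing against \<open>m \<cdot> e\<close> the other.\<close>

lemma CoCart_comparison_Iso:
  assumes e: "e \<in> CoCart C D F" and m: "m \<in> Arr C" "Dom C m = Cod C e"
    and me: "m \<cdot>\<^bsub>C\<^esub> e \<in> CoCart C D F" and over: "farr F m = Idt D (fobj F (Cod C e))"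
  shows "m \<in> Iso C"
proof -
  note e' = CoCart_Arr[OF e]
  note c = dom.Comp_props[OF e' m(1) m(2)[symmetric]]
  have o: "fobj F (Cod C m) = fobj F (Cod C e)"
    using over farr_props[OF m(1)] cod.Idt_props(3) dom.Cod_Obj[OF e'] fobj_Obj by metis
  have ob: "fobj F (Cod C e) \<in> Obj D" "Cod C e \<in> Obj C" "Cod C m \<in> Obj C"
    using dom.Cod_Obj[OF e'] dom.Cod_Obj[OF m(1)] fobj_Obj by auto
  have Fme: "farr F (m \<cdot>\<^bsub>C\<^esub> e) = farr F e"
    using e' m over by (simp add: farr_Comp' farr_props cod.Idt_Comp')
  obtain n where n: "n \<in> Arr C" "Dom C n = Cod C m" "Cod C n = Cod C e" "n \<cdot>\<^bsub>C\<^esub> (m \<cdot>\<^bsub>C\<^esub> e) = e"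
    "farr F n = Idt D (fobj F (Cod C e))"
    using CoCartE[OF me, of e "Idt D (fobj F (Cod C e))"] c e' Fme ob o
    by (auto simp: cod.Idt_props farr_props cod.Idt_Comp')
  have nm: "n \<cdot>\<^bsub>C\<^esub> m = Idt C (Cod C e)"
    using e' m n ob over dom.Comp_assoc'[of e m n]
    by - (rule CoCart_eqI[OF e];
        auto simp: dom.Comp_props dom.Idt_props farr_Comp' farr_Idt dom.Idt_Comp' cod.Idt_Comp' cod.Idt_props)
  have "(m \<cdot>\<^bsub>C\<^esub> n) \<cdot>\<^bsub>C\<^esub> (m \<cdot>\<^bsub>C\<^esub> e) = m \<cdot>\<^bsub>C\<^esub> e"
    using m n c dom.Comp_assoc'[of "m \<cdot>\<^bsub>C\<^esub> e" n m] by simp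
  then have "m \<cdot>\<^bsub>C\<^esub> n = Idt C (Cod C m)"
    using e' m n ob over o c
    by - (rule CoCart_eqI[OF me];
        auto simp: dom.Comp_props dom.Idt_props farr_Comp' farr_Idt dom.Idt_Comp' cod.Idt_Comp' cod.Idt_props)
  with nm m n show ?thesis
    by (intro dom.IsoI[where g = n]) auto
qed

section \<open>Vertical arrows and the functor \<open>kappa\<close>\<close>

text \<open>The domain of an identity determines it, so a vertical arrow can only lie over the
  identity of the image of its own domain.\<close>

lemma Vert_over: "f \<in> Vert C D F \<longleftrightarrow> f \<in> Arr C \<and> farr F f = Idt D (fobj F (Dom C f))"
  using farr_props(2)[of f] cod.Idt_props(2) fobj_Obj dom.Dom_Obj
  by (auto simp: Vert_def identities_def)

lemma Vert_fobj: "f \<in> Vert C D F \<Longrightarrow> fobj F (Cod C f) = fobj F (Dom C f)"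
  using farr_props(3)[of f] cod.Idt_props(3) fobj_Obj dom.Dom_Obj by (metis Vert_over)

lemma wide_subcategory_Vert: "wide_subcategory C (Vert C D F)"
proof -
  have "g \<cdot>\<^bsub>C\<^esub> f \<in> Vert C D F"
    if "f \<in> Vert C D F" "g \<in> Vert C D F" "Cod C f = Dom C g" for f g
  proof -
    have *: "f \<in> Arr C" "g \<in> Arr C" "farr F f = Idt D (fobj F (Dom C f))"
      "farr F g = Idt D (fobj F (Dom C f))"
      using that Vert_fobj[of f] by (auto simp: Vert_over)
    moreover from this have "fobj F (Dom C f) \<in> Obj D"
      using dom.Dom_Obj fobj_Obj by blast
    ultimately show ?thesis
      using that(3) by (simp add: Vert_over dom.Comp_props farr_Comp' cod.Idt_Comp' cod.Idt_props)
  qed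
  then show ?thesis
    by (auto simp: wide_subcategory_def Vert_def identities_def dom.Idt_props farr_Idt fobj_Obj)
qed

lemma kappa_functor: "cat_functor (arrow_cat C) (comma_cat C D F) (kappa C F)"
proof -
  interpret A: category "arrow_cat C" by (rule dom.category_arrow_cat)
  interpret K: category "comma_cat C D F" by (rule category_comma_cat)
  show ?thesis
    by unfold_locales
      (auto simp: kappa_def arrow_cat_def comma_cat_def hom_def farr_props farr_Idt dom.Dom_Obj
        dom.Cod_Obj farr_Comp',
        metis farr_Comp')
qed

end

section \<open>The algebra of a split cofibration\<close>

context split_cofibration
begin

text \<open>From here on \<open>F\<close> is the algebra, and the generic functor \<open>F\<close>
  of the previous section is instantiated to \<open>P\<close>.\<close>

abbreviation F :: "('ea, 'ea square, 'eo, 'ea) funct" where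
  "F \<equiv> F_algebra E B P \<delta>"

text \<open>The chosen lift of the image of \<open>f\<close>, starting where \<open>f\<close>
  starts; it turns out to be the left factor of \<open>f\<close>
  (\<open>left_factor_F\<close>).\<close>

abbreviation lift :: "'ea \<Rightarrow> 'ea" where
  "lift f \<equiv> \<delta> (Dom E f) (farr P f)"

lemma lift_props:
  assumes "f \<in> Arr E"
  shows "lift f \<in> Arr E" "Dom E (lift f) = Dom E f" "farr P (lift f) = farr P f"
    "Cod E (lift f) \<in> Obj E" "fobj P (Cod E (lift f)) = fobj P (Cod E f)"
    "lift f \<in> CoCart E B P" "lift f \<in> Delta E B P \<delta>"
proof -
  have *: "Dom E f \<in> Obj E" "farr P f \<in> Arr B" "Dom B (farr P f) = fobj P (Dom E f)"
    using assms by (simp_all add: farr_props dom.Dom_Obj)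
  show "lift f \<in> Arr E" "Dom E (lift f) = Dom E f" "farr P (lift f) = farr P f"
    "Cod E (lift f) \<in> Obj E" "fobj P (Cod E (lift f)) = fobj P (Cod E f)"
    using delta_props[OF *] assms by (simp_all add: farr_props)
  show "lift f \<in> CoCart E B P" "lift f \<in> Delta E B P \<delta>"
    using cleavage_CoCart[OF *] * by (auto simp: Delta_def)
qed

lemma lift_Idt: "x \<in> Obj E \<Longrightarrow> lift (Idt E x) = Idt E x"
  by (simp add: dom.Idt_props farr_Idt split_Idt)

text \<open>An arrow \<open>\<delta> x u\<close> remembers \<open>x\<close> as its domain and
  \<open>u\<close> as its image, so it is the lift of itself; membership in \<open>Delta\<close>
  becomes a fixed-point equation.\<close>

lemma Delta_lift: "f \<in> Delta E B P \<delta> \<longleftrightarrow> f \<in> Arr E \<and> lift f = f"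
proof
  assume "f \<in> Delta E B P \<delta>"
  then show "f \<in> Arr E \<and> lift f = f"
    by (auto simp: Delta_def delta_props)
next
  assume "f \<in> Arr E \<and> lift f = f"
  then show "f \<in> Delta E B P \<delta>"
    using lift_props(7)[of f] by simp
qed

lemma lift_Comp:
  assumes f: "f \<in> Arr E" and v: "v \<in> Arr B" "Dom B v = fobj P (Cod E f)"
  shows "\<delta> (Dom E f) (v \<cdot>\<^bsub>B\<^esub> farr P f) = \<delta> (Cod E (lift f)) v \<cdot>\<^bsub>E\<^esub> lift f"
  using split_Comp[of "Dom E f" "farr P f" "fobj P (Cod E f)" v "Cod B v"] assms
  by (simp add: hom_def farr_props dom.Dom_Obj)

lemma fobj_F: "fobj F f = Cod E (lift f)"
  by (simp add: F_algebra_def comp_functor_def L_functor_def kappa_def)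

lemma F_functor: "cat_functor (arrow_cat E) E F"
  unfolding F_algebra_def by (rule cat_functor_comp[OF kappa_functor L_functor_functor])

text \<open>The characterization of \<open>L_functor\<close> transported along \<open>kappa\<close>.
  Together with its converse \<open>F_eqI\<close> it replaces the definite description in all later
  computations.\<close>

lemma F_arr:
  assumes "(f, g, r, s) \<in> Arr (arrow_cat E)"
  shows "farr F (f, g, r, s) \<in> Arr E" "Dom E (farr F (f, g, r, s)) = Cod E (lift f)"
    "Cod E (farr F (f, g, r, s)) = Cod E (lift g)" "farr P (farr F (f, g, r, s)) = farr P s"
    "farr F (f, g, r, s) \<cdot>\<^bsub>E\<^esub> lift f = lift g \<cdot>\<^bsub>E\<^esub> r"
proof -
  interpret K: cat_functor "arrow_cat E" "comma_cat E B P" "kappa E P" by (rule kappa_functor)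
  have "((Dom E f, farr P f), (Dom E g, farr P g), r, farr P s) \<in> Arr (comma_cat E B P)"
    using K.farr_props(1)[OF assms] by (simp add: kappa_def)
  from L_functor_arr[OF this]
  show "farr F (f, g, r, s) \<in> Arr E" "Dom E (farr F (f, g, r, s)) = Cod E (lift f)"
    "Cod E (farr F (f, g, r, s)) = Cod E (lift g)" "farr P (farr F (f, g, r, s)) = farr P s"
    "farr F (f, g, r, s) \<cdot>\<^bsub>E\<^esub> lift f = lift g \<cdot>\<^bsub>E\<^esub> r"
    by (simp_all add: F_algebra_def comp_functor_def kappa_def hom_def)
qed

text \<open>\<open>lift f\<close> is cocartesian, so its composite with the value of
  \<open>F\<close> and the image under \<open>P\<close> determine that value.\<close>

lemma F_eqI:
  assumes "(f, g, r, s) \<in> Arr (arrow_cat E)"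
    and "l \<in> Arr E" "Dom E l = Cod E (lift f)" "Cod E l = Cod E (lift g)"
    and "farr P l = farr P s" "l \<cdot>\<^bsub>E\<^esub> lift f = lift g \<cdot>\<^bsub>E\<^esub> r"
  shows "farr F (f, g, r, s) = l"
proof -
  have "f \<in> Arr E"
    using assms(1) by (simp add: arrow_cat_def)
  then show ?thesis
    using F_arr[OF assms(1)] assms(2-) by - (rule CoCart_eqI[OF lift_props(6)[of f]]; auto)
qed

section \<open>The strict algebra laws\<close>

text \<open>By \<open>split_Idt\<close> the lifts of identities are identities, so the conditions in
  \<open>F_eqI\<close> reduce to the unit laws for \<open>f\<close>.\<close>

lemma F_unit: "functor_eq E (F \<circ>\<^sub>F S_unit E) id_functor"
proof -
  have "farr F (Idt E (Dom E f), Idt E (Cod E f), f, f) = f" if f: "f \<in> Arr E" for f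
  proof (rule F_eqI)
    show "(Idt E (Dom E f), Idt E (Cod E f), f, f) \<in> Arr (arrow_cat E)"
      using f by (simp add: arrow_cat_def hom_def dom.Idt_props dom.Dom_Obj dom.Cod_Obj
          dom.Idt_Comp' dom.Comp_Idt')
  qed (use f in \<open>simp_all add: lift_Idt dom.Idt_props dom.Dom_Obj dom.Cod_Obj
          dom.Idt_Comp' dom.Comp_Idt' farr_Idt split_Idt\<close>)
  then show ?thesis
    by (simp add: functor_eq_def comp_functor_def S_unit_def id_functor_def fobj_F dom.Idt_props
        farr_Idt split_Idt)
qed

text \<open>The lift along a diagonal is a composite of two chosen lifts by
  \<open>split_Comp\<close>. This makes the objects agree on the nose; on arrows, the right-hand
  side then satisfies the conditions that \<open>F_eqI\<close> imposes on the left-hand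
  side.\<close>

lemma F_mult:
  "functor_eq (arrow_cat (arrow_cat E)) (F \<circ>\<^sub>F S_mult E) (F \<circ>\<^sub>F arrow_functor F)"
proof -
  \<comment> \<open>The image of the square under \<open>F\<close> starts at the codomain of
    \<open>lift f\<close> and lies over the image of \<open>s\<close>, so its lift is the second
    factor in \<open>lift_Comp\<close>.\<close>
  have lift_diagonal: "lift (s \<cdot>\<^bsub>E\<^esub> f) = lift (farr F (f, g, r, s)) \<cdot>\<^bsub>E\<^esub> lift f"
    if "(f, g, r, s) \<in> Arr (arrow_cat E)" for f g r s
  proof -
    have "f \<in> Arr E" "s \<in> Arr E" "Cod E f = Dom E s"
      using that by (auto simp: arrow_cat_def hom_def)
    then show ?thesis
      using F_arr[OF that] lift_Comp[of f "farr P s"]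
      by (simp add: farr_Comp' farr_props dom.Comp_props)
  qed
  have lift_F: "lift (farr F q) \<in> Arr E" "Dom E (lift (farr F q)) = Cod E (lift f)"
    if "q = (f, g, r, s)" "q \<in> Arr (arrow_cat E)" for q f g r s
    using that F_arr[of f g r s] lift_props(1,2)[of "farr F q"] by auto
  have obj: "Cod E (lift (diagonal E \<sigma>)) = Cod E (lift (farr F \<sigma>))"
    if "\<sigma> \<in> Arr (arrow_cat E)" for \<sigma>
  proof -
    obtain f g r s where \<sigma>: "\<sigma> = (f, g, r, s)"
      by (metis surj_pair)
    have "f \<in> Arr E"
      using that by (auto simp: \<sigma> arrow_cat_def)
    then show ?thesis
      using that lift_F[OF \<sigma> that] lift_diagonal[of f g r s] lift_props[of f]
      by (simp add: \<sigma> diagonal_def dom.Comp_props)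
  qed
  have arr: "farr F (farr (S_mult E) c) = farr F (farr (arrow_functor F) c)"
    if c: "c \<in> Arr (arrow_cat (arrow_cat E))" for c
  proof -
    interpret F: cat_functor "arrow_cat E" E F by (rule F_functor)
    \<comment> \<open>The arrow \<open>c\<close> is a commutative cube: the squares
      \<open>\<sigma>\<close> and \<open>\<tau>\<close> are its source and target, joined by the
      squares \<open>\<alpha>\<close> and \<open>\<beta>\<close>.\<close>
    obtain \<sigma> \<tau> \<alpha> \<beta> where c': "c = (\<sigma>, \<tau>, \<alpha>, \<beta>)"
      by (metis surj_pair)
    obtain f g p q where \<sigma>: "\<sigma> = (f, g, p, q)"
      by (metis surj_pair)
    obtain f' g' p' q' where \<tau>: "\<tau> = (f', g', p', q')"
      by (metis surj_pair)
    have st: "\<sigma> \<in> Arr (arrow_cat E)" "\<tau> \<in> Arr (arrow_cat E)" "\<alpha> \<in> Arr (arrow_cat E)"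
      "\<beta> \<in> Arr (arrow_cat E)" "\<alpha> \<in> hom (arrow_cat E) f f'" "\<beta> \<in> hom (arrow_cat E) g g'"
      "\<beta> \<cdot>\<^bsub>arrow_cat E\<^esub> \<sigma> = \<tau> \<cdot>\<^bsub>arrow_cat E\<^esub> \<alpha>"
      \<comment> \<open>Unfolding only the outer arrow category first keeps the faces of the cube as
        arrows of \<open>arrow_cat E\<close>.\<close>
      using c by (auto simp: c' \<sigma> \<tau> arrow_cat_def[of "arrow_cat E"] hom_def)
        (auto simp: arrow_cat_def)
    obtain r r' s s' where \<alpha>: "\<alpha> = (f, f', r, r')" and \<beta>: "\<beta> = (g, g', s, s')"
      using st(5,6) by (cases \<alpha>, cases \<beta>) (auto simp: hom_def arrow_cat_def)
    have E: "f \<in> Arr E" "g \<in> Arr E" "p \<in> Arr E" "q \<in> Arr E" "f' \<in> Arr E" "g' \<in> Arr E"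
      "p' \<in> Arr E" "q' \<in> Arr E" "r \<in> Arr E" "r' \<in> Arr E" "s \<in> Arr E" "s' \<in> Arr E"
      "Dom E q = Cod E f" "Cod E q = Cod E g" "Dom E q' = Cod E f'" "Cod E q' = Cod E g'"
      "Dom E r = Dom E f" "Cod E r = Dom E f'" "Dom E r' = Cod E f" "Cod E r' = Cod E f'"
      "Dom E s' = Cod E g" "Cod E s' = Cod E g'"
      and comm: "r' \<cdot>\<^bsub>E\<^esub> f = f' \<cdot>\<^bsub>E\<^esub> r"
      using st by (auto simp: \<sigma> \<tau> \<alpha> \<beta> arrow_cat_def hom_def)
    \<comment> \<open>This is the codomain component of the equation between the composites of
      squares.\<close>
    have cube: "s' \<cdot>\<^bsub>E\<^esub> q = q' \<cdot>\<^bsub>E\<^esub> r'"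
      using st(7) by (simp add: \<sigma> \<tau> \<alpha> \<beta> arrow_cat_def)
    \<comment> \<open>Functoriality of \<open>F\<close> turns the equation between composites of
      squares into a commutative square in \<open>E\<close>.\<close>
    have Fsq: "(farr F \<sigma>, farr F \<tau>, farr F \<alpha>, farr F \<beta>) \<in> Arr (arrow_cat E)"
    proof -
      have "farr F (\<beta> \<cdot>\<^bsub>arrow_cat E\<^esub> \<sigma>) = farr F \<beta> \<cdot>\<^bsub>E\<^esub> farr F \<sigma>"
        "farr F (\<tau> \<cdot>\<^bsub>arrow_cat E\<^esub> \<alpha>) = farr F \<tau> \<cdot>\<^bsub>E\<^esub> farr F \<alpha>"
        using st by (intro F.farr_Comp'; simp add: \<sigma> \<tau> \<alpha> \<beta> arrow_cat_def)+
      then have "farr F \<beta> \<cdot>\<^bsub>E\<^esub> farr F \<sigma> = farr F \<tau> \<cdot>\<^bsub>E\<^esub> farr F \<alpha>"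
        using st(7) by simp
      moreover note F_arr[of f g p q] F_arr[of f' g' p' q'] F_arr[of f f' r r'] F_arr[of g g' s s']
      ultimately show ?thesis
        using st by (simp add: \<sigma> \<tau> \<alpha> \<beta> arrow_cat_def[where E = E] hom_def)
    qed
    let ?k = "farr F (farr F \<sigma>, farr F \<tau>, farr F \<alpha>, farr F \<beta>)"
    note k = F_arr[OF Fsq]
    note F\<sigma> = F_arr[of f g p q, folded \<sigma>, OF st(1)] and F\<tau> = F_arr[of f' g' p' q', folded \<tau>, OF st(2)]
      and F\<alpha> = F_arr[of f f' r r', folded \<alpha>, OF st(3)] and F\<beta> = F_arr[of g g' s s', folded \<beta>, OF st(4)]
    have "farr F (q \<cdot>\<^bsub>E\<^esub> f, q' \<cdot>\<^bsub>E\<^esub> f', r, s') = ?k"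
    proof (rule F_eqI)
      have "s' \<cdot>\<^bsub>E\<^esub> (q \<cdot>\<^bsub>E\<^esub> f) = (s' \<cdot>\<^bsub>E\<^esub> q) \<cdot>\<^bsub>E\<^esub> f"
        using E by (intro dom.Comp_assoc'[symmetric]) auto
      also have "\<dots> = q' \<cdot>\<^bsub>E\<^esub> (r' \<cdot>\<^bsub>E\<^esub> f)"
        unfolding cube using E by (intro dom.Comp_assoc') auto
      also have "\<dots> = (q' \<cdot>\<^bsub>E\<^esub> f') \<cdot>\<^bsub>E\<^esub> r"
        unfolding comm using E by (intro dom.Comp_assoc'[symmetric]) auto
      finally show "(q \<cdot>\<^bsub>E\<^esub> f, q' \<cdot>\<^bsub>E\<^esub> f', r, s') \<in> Arr (arrow_cat E)"
        using E by (simp add: arrow_cat_def hom_def dom.Comp_props)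
      show "?k \<in> Arr E" "farr P ?k = farr P s'"
        using k F\<beta> by auto
      show "Dom E ?k = Cod E (lift (q \<cdot>\<^bsub>E\<^esub> f))" "Cod E ?k = Cod E (lift (q' \<cdot>\<^bsub>E\<^esub> f'))"
        using k obj[OF st(1)] obj[OF st(2)] by (auto simp: \<sigma> \<tau> diagonal_def)
      \<comment> \<open>Two squares are pasted: that of \<open>?k\<close> over the lifts of the
        images of \<open>\<sigma>\<close> and \<open>\<tau>\<close>, and that of the image of
        \<open>\<alpha>\<close> over \<open>lift f\<close> and \<open>lift f'\<close>.\<close>
      have "?k \<cdot>\<^bsub>E\<^esub> lift (q \<cdot>\<^bsub>E\<^esub> f) = ?k \<cdot>\<^bsub>E\<^esub> (lift (farr F \<sigma>) \<cdot>\<^bsub>E\<^esub> lift f)"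
        using lift_diagonal st(1) by (simp add: \<sigma>)
      also have "\<dots> = (?k \<cdot>\<^bsub>E\<^esub> lift (farr F \<sigma>)) \<cdot>\<^bsub>E\<^esub> lift f"
        by (rule dom.Comp_assoc'[symmetric])
          (simp_all only: k(1,2) lift_props(1)[OF E(1)] lift_F[OF \<sigma> st(1)])
      also have "\<dots> = (lift (farr F \<tau>) \<cdot>\<^bsub>E\<^esub> farr F \<alpha>) \<cdot>\<^bsub>E\<^esub> lift f"
        by (simp only: k(5))
      also have "\<dots> = lift (farr F \<tau>) \<cdot>\<^bsub>E\<^esub> (farr F \<alpha> \<cdot>\<^bsub>E\<^esub> lift f)"
        by (rule dom.Comp_assoc')
          (simp_all only: F\<alpha>(1-3) lift_props(1)[OF E(1)] lift_F[OF \<tau> st(2)])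
      also have "\<dots> = lift (farr F \<tau>) \<cdot>\<^bsub>E\<^esub> (lift f' \<cdot>\<^bsub>E\<^esub> r)"
        by (simp only: F\<alpha>(5))
      also have "\<dots> = (lift (farr F \<tau>) \<cdot>\<^bsub>E\<^esub> lift f') \<cdot>\<^bsub>E\<^esub> r"
        by (rule dom.Comp_assoc'[symmetric])
          (simp_all only: E lift_props(1,2)[OF E(5)] lift_F[OF \<tau> st(2)])
      also have "\<dots> = lift (q' \<cdot>\<^bsub>E\<^esub> f') \<cdot>\<^bsub>E\<^esub> r"
        using lift_diagonal st(2) by (simp add: \<tau>)
      finally show "?k \<cdot>\<^bsub>E\<^esub> lift (q \<cdot>\<^bsub>E\<^esub> f) = lift (q' \<cdot>\<^bsub>E\<^esub> f') \<cdot>\<^bsub>E\<^esub> r" .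
    qed
    then show ?thesis
      by (simp add: c' \<alpha> \<beta> S_mult_def arrow_functor_def) (simp add: \<sigma> \<tau> diagonal_def)
  qed
  show ?thesis
    unfolding functor_eq_def comp_functor_def
    using obj arr by (simp add: fobj_F) (simp add: S_mult_def arrow_functor_def arrow_cat_def)
qed

lemma strict_S_algebra_F_algebra: "strict_S_algebra E F"
  using F_functor F_unit F_mult by (simp add: strict_S_algebra_def)

section \<open>The factorization systems\<close>

lemma left_factor_F:
  assumes f: "f \<in> Arr E"
  shows "left_factor E F f = lift f"
  unfolding left_factor_def
proof (rule F_eqI)
  show "(Idt E (Dom E f), f, Idt E (Dom E f), f) \<in> Arr (arrow_cat E)"
    using f by (simp add: arrow_cat_def hom_def dom.Idt_props dom.Dom_Obj)
qed (use f lift_props[OF f] in \<open>simp_all add: dom.Idt_props dom.Dom_Obj farr_Idt split_Idt\<close>)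

text \<open>The lift of the identity of \<open>Cod E f\<close> is that identity, so the square
  defining the right factor collapses to a triangle: the right factor is the comparison from
  \<open>lift f\<close> to \<open>f\<close>.\<close>

lemma right_factor_props:
  assumes f: "f \<in> Arr E"
  shows "right_factor E F f \<in> Arr E" "Dom E (right_factor E F f) = Cod E (lift f)"
    "Cod E (right_factor E F f) = Cod E f" "right_factor E F f \<in> Vert E B P"
    "right_factor E F f \<cdot>\<^bsub>E\<^esub> lift f = f"
proof -
  have "(f, Idt E (Cod E f), f, Idt E (Cod E f)) \<in> Arr (arrow_cat E)"
    using f by (simp add: arrow_cat_def hom_def dom.Idt_props dom.Cod_Obj)
  note m = F_arr[OF this, folded right_factor_def]
  have id: "lift (Idt E (Cod E f)) = Idt E (Cod E f)"
    using f by (simp add: dom.Cod_Obj lift_Idt)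
  show "right_factor E F f \<in> Arr E" "Dom E (right_factor E F f) = Cod E (lift f)"
    "Cod E (right_factor E F f) = Cod E f" "right_factor E F f \<cdot>\<^bsub>E\<^esub> lift f = f"
    using m f unfolding id by (auto simp: dom.Idt_props dom.Cod_Obj dom.Idt_Comp')
  show "right_factor E F f \<in> Vert E B P"
    using m f lift_props[OF f] by (simp add: Vert_over farr_Idt dom.Cod_Obj)
qed

section \<open>The strict factorization system\<close>

text \<open>A vertical \<open>m\<close> changes neither the domain nor the image of
  \<open>e\<close>, so \<open>e\<close> and \<open>m \<cdot> e\<close> have the same lift, which is
  \<open>e\<close>. Cancelling this cocartesian arrow determines \<open>m\<close>.\<close>

lemma Delta_Vert_factorization_unique:
  assumes e: "e \<in> Delta E B P \<delta>" and m: "m \<in> Vert E B P" and em: "Cod E e = Dom E m"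
  shows "e = lift (m \<cdot>\<^bsub>E\<^esub> e)" "m = right_factor E F (m \<cdot>\<^bsub>E\<^esub> e)"
proof -
  have e': "e \<in> Arr E" "lift e = e" and m': "m \<in> Arr E" "farr P m = Idt B (fobj P (Dom E m))"
    using e m by (auto simp: Delta_lift Vert_over)
  note c = dom.Comp_props[OF e'(1) m'(1) em]
  have "farr P (m \<cdot>\<^bsub>E\<^esub> e) = farr P e"
    using e' m' em by (simp add: farr_Comp' cod.Idt_Comp' farr_props)
  then show l: "e = lift (m \<cdot>\<^bsub>E\<^esub> e)"
    using c e' by simp
  note r = right_factor_props[OF c(1)]
  show "m = right_factor E F (m \<cdot>\<^bsub>E\<^esub> e)"
  proof (rule CoCart_eqI[OF lift_props(6)[OF c(1)]])
    show "farr P m = farr P (right_factor E F (m \<cdot>\<^bsub>E\<^esub> e))"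
      using r(2,4) m' em l by (simp add: Vert_over)
  qed (use r m' em c l in auto)
qed

text \<open>This is where the splitting enters the strict system: \<open>lift_Comp\<close> gives
  closure under composition, and \<open>lift_Idt\<close> gives the identities.\<close>

lemma wide_subcategory_Delta: "wide_subcategory E (Delta E B P \<delta>)"
proof -
  have "g \<cdot>\<^bsub>E\<^esub> f \<in> Delta E B P \<delta>"
    if "f \<in> Delta E B P \<delta>" "g \<in> Delta E B P \<delta>" "Cod E f = Dom E g" for f g
    using that lift_Comp[of f "farr P g"] by (simp add: Delta_lift dom.Comp_props farr_Comp' farr_props)
  moreover have "identities E \<subseteq> Delta E B P \<delta>"
    unfolding identities_def Delta_lift subset_iff
    using lift_Idt dom.Idt_props by blast
  ultimately show ?thesis
    by (auto simp: wide_subcategory_def Delta_lift)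
qed

lemma strict_factorization_system_Delta_Vert:
  "strict_factorization_system E (Delta E B P \<delta>, Vert E B P)"
proof -
  have "\<exists>!p. fst p \<in> Delta E B P \<delta> \<and> snd p \<in> Vert E B P \<and> Cod E (fst p) = Dom E (snd p) \<and>
      f = snd p \<cdot>\<^bsub>E\<^esub> fst p" if f: "f \<in> Arr E" for f
  proof (rule ex1I[where a = "(lift f, right_factor E F f)"])
    fix p
    assume "fst p \<in> Delta E B P \<delta> \<and> snd p \<in> Vert E B P \<and> Cod E (fst p) = Dom E (snd p) \<and>
      f = snd p \<cdot>\<^bsub>E\<^esub> fst p"
    then show "p = (lift f, right_factor E F f)"
      using Delta_Vert_factorization_unique[of "fst p" "snd p"] by (simp add: prod_eq_iff)
  qed (use right_factor_props[OF f] lift_props[OF f] in auto)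
  then show ?thesis
    using wide_subcategory_Delta wide_subcategory_Vert
    by (simp add: strict_factorization_system_def)
qed

lemma right_factor_identity_iff:
  assumes f: "f \<in> Arr E"
  shows "right_factor E F f \<in> identities E \<longleftrightarrow> f \<in> Delta E B P \<delta>"
proof
  note m = right_factor_props[OF f]
  assume "right_factor E F f \<in> identities E"
  then have "right_factor E F f = Idt E (Cod E (lift f))"
    using m(2) by (auto simp: identities_def dom.Idt_props)
  then show "f \<in> Delta E B P \<delta>"
    using m(5) lift_props[OF f] by (simp add: dom.Idt_Comp')
next
  assume f': "f \<in> Delta E B P \<delta>"
  have "Idt E (Cod E f) \<in> Vert E B P"
    using f dom.Cod_Obj by (auto simp: Vert_over dom.Idt_props farr_Idt)
  \<comment> \<open>The trivial factorization of \<open>f\<close> through an identity is of the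
    required form, hence is the canonical one.\<close>
  then have "Idt E (Cod E f) = right_factor E F f"
    using Delta_Vert_factorization_unique(2)[OF f', of "Idt E (Cod E f)"] f
    by (simp add: dom.Idt_props dom.Cod_Obj dom.Idt_Comp')
  then show "right_factor E F f \<in> identities E"
    using dom.Cod_Obj[OF f] by (metis identities_def imageI)
qed

text \<open>Applying \<open>P\<close> to an identity lift shows that \<open>f\<close> is vertical;
  conversely \<open>split_Idt\<close> makes the lift of a vertical arrow an identity.\<close>

lemma left_factor_identity_iff:
  assumes f: "f \<in> Arr E"
  shows "left_factor E F f \<in> identities E \<longleftrightarrow> f \<in> Vert E B P"
  unfolding left_factor_F[OF f]
proof
  assume "lift f \<in> identities E"
  then obtain x where x: "x \<in> Obj E" "lift f = Idt E x"
    by (auto simp: identities_def)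
  then have "farr P f = Idt B (fobj P x)" "x = Dom E f"
    using lift_props[OF f] by (auto simp: farr_Idt dom.Idt_props)
  then show "f \<in> Vert E B P"
    using f by (simp add: Vert_over)
next
  assume "f \<in> Vert E B P"
  then show "lift f \<in> identities E"
    using f dom.Dom_Obj by (auto simp: Vert_over split_Idt identities_def)
qed

lemma corresponding_sfs_F_algebra: "corresponding_sfs E F = (Delta E B P \<delta>, Vert E B P)"
  using right_factor_identity_iff left_factor_identity_iff
  by (auto simp: corresponding_sfs_def Delta_lift Vert_def)

section \<open>The associated orthogonal factorization system\<close>

lemma right_factor_Iso_iff:
  assumes f: "f \<in> Arr E"
  shows "right_factor E F f \<in> Iso E \<longleftrightarrow> f \<in> CoCart E B P"
proof
  note m = right_factor_props[OF f] and l = lift_props(6)[OF f]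
  show "f \<in> CoCart E B P" if "right_factor E F f \<in> Iso E"
    using CoCart_Comp[OF l Iso_CoCart[OF that]] m by simp
  show "right_factor E F f \<in> Iso E" if "f \<in> CoCart E B P"
    using CoCart_comparison_Iso[OF l m(1,2)] m that by (simp add: Vert_over)
qed

lemma left_factor_Iso_iff:
  assumes f: "f \<in> Arr E"
  shows "left_factor E F f \<in> Iso E \<longleftrightarrow> f \<in> inverse_Iso E B P"
  using CoCart_over_Iso[OF lift_props(6)[OF f]] farr_Iso[of "lift f"] lift_props(3)[OF f] f
  by (auto simp: left_factor_F inverse_Iso_def)

lemma associated_ofs_F_algebra: "associated_ofs E F = (CoCart E B P, inverse_Iso E B P)"
  using right_factor_Iso_iff left_factor_Iso_iff CoCart_Arr
  by (auto simp: associated_ofs_def inverse_Iso_def)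

text \<open>Invertibility of the image of \<open>q\<close> fixes the image of any diagonal, and the
  cocartesian \<open>l\<close> has exactly one extension of \<open>r\<close> over it.\<close>

lemma CoCart_orthogonal_inverse_Iso:
  assumes l: "l \<in> CoCart E B P" and q: "q \<in> inverse_Iso E B P"
    and sq: "(l, q, r, s) \<in> Arr (arrow_cat E)"
  shows "\<exists>!d. d \<in> hom E (Cod E l) (Dom E q) \<and> d \<cdot>\<^bsub>E\<^esub> l = r \<and> q \<cdot>\<^bsub>E\<^esub> d = s"
proof -
  have E: "l \<in> Arr E" "q \<in> Arr E" "r \<in> Arr E" "s \<in> Arr E" "Dom E r = Dom E l"
    "Cod E r = Dom E q" "Dom E s = Cod E l" "Cod E s = Cod E q" "s \<cdot>\<^bsub>E\<^esub> l = q \<cdot>\<^bsub>E\<^esub> r"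
    using sq by (auto simp: arrow_cat_def hom_def)
  obtain i where i: "i \<in> Arr B" "Dom B i = fobj P (Cod E q)" "Cod B i = fobj P (Dom E q)"
    "i \<cdot>\<^bsub>B\<^esub> farr P q = Idt B (fobj P (Dom E q))" "farr P q \<cdot>\<^bsub>B\<^esub> i = Idt B (fobj P (Cod E q))"
    using q E(2) cod.IsoE[of "farr P q"] by (auto simp: inverse_Iso_def farr_props)
  \<comment> \<open>An arrow into \<open>Dom E q\<close> has its image determined by its composite
    with \<open>q\<close>; this serves for \<open>r\<close> and again for the uniqueness of the
    diagonal.\<close>
  have over: "farr P d = i \<cdot>\<^bsub>B\<^esub> farr P (q \<cdot>\<^bsub>E\<^esub> d)" if "d \<in> Arr E" "Cod E d = Dom E q" for d
    using that E(2) i cod.cancel_left_inverse[of "farr P d" "farr P q" i]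
    by (simp add: farr_Comp' farr_props)
  let ?v = "i \<cdot>\<^bsub>B\<^esub> farr P s"
  have v: "?v \<in> Arr B" "Dom B ?v = fobj P (Cod E l)" "Cod B ?v = fobj P (Dom E q)"
    using E i by (simp_all add: cod.Comp_props farr_props)
  have "farr P r = i \<cdot>\<^bsub>B\<^esub> farr P (s \<cdot>\<^bsub>E\<^esub> l)"
    using over[OF E(3,6)] by (simp only: E(9))
  also have "\<dots> = i \<cdot>\<^bsub>B\<^esub> (farr P s \<cdot>\<^bsub>B\<^esub> farr P l)"
    using E(1,4,7) by (simp add: farr_Comp')
  also have "\<dots> = ?v \<cdot>\<^bsub>B\<^esub> farr P l"
    using E(1,4,7,8) i(1,2) by (intro cod.Comp_assoc'[symmetric]) (simp_all add: farr_props)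
  finally have "farr P r = ?v \<cdot>\<^bsub>B\<^esub> farr P l" .
  then obtain d where d: "d \<in> Arr E" "Dom E d = Cod E l" "Cod E d = Dom E q" "d \<cdot>\<^bsub>E\<^esub> l = r"
    "farr P d = ?v"
    using CoCartE[OF l, of r ?v] E v by auto
  \<comment> \<open>The lower triangle is not part of the universal property; it is tested against
    \<open>l\<close>.\<close>
  have "q \<cdot>\<^bsub>E\<^esub> d = s"
  proof (rule CoCart_eqI[OF l])
    show "(q \<cdot>\<^bsub>E\<^esub> d) \<cdot>\<^bsub>E\<^esub> l = s \<cdot>\<^bsub>E\<^esub> l"
      using dom.Comp_assoc'[of l d q] E(1,2) d(1-3) by (simp add: d(4) E(9))
    have "farr P (q \<cdot>\<^bsub>E\<^esub> d) = farr P q \<cdot>\<^bsub>B\<^esub> ?v"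
      using E(2) d(1,3) by (simp add: farr_Comp' d(5))
    also have "\<dots> = farr P s"
      using E(2,4,8) i by (intro cod.cancel_left_inverse) (simp_all add: farr_props)
    finally show "farr P (q \<cdot>\<^bsub>E\<^esub> d) = farr P s" .
  qed (use E d in \<open>auto simp: dom.Comp_props\<close>)
  then have "d \<in> hom E (Cod E l) (Dom E q) \<and> d \<cdot>\<^bsub>E\<^esub> l = r \<and> q \<cdot>\<^bsub>E\<^esub> d = s"
    using d(1-4) by (simp add: hom_def)
  moreover have "k = d" if k: "k \<in> hom E (Cod E l) (Dom E q)" "k \<cdot>\<^bsub>E\<^esub> l = r" "q \<cdot>\<^bsub>E\<^esub> k = s" for k
  proof (rule CoCart_eqI[OF l])
    show "k \<in> Arr E" "Dom E k = Cod E l" "d \<in> Arr E" "Dom E d = Cod E l" "Cod E k = Cod E d"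
      using k(1) d(1-3) by (simp_all add: hom_def)
    then show "farr P k = farr P d"
      using over[of k] k(3) d(3,5) by simp
    show "k \<cdot>\<^bsub>E\<^esub> l = d \<cdot>\<^bsub>E\<^esub> l"
      using k(2) d(4) by simp
  qed
  ultimately show ?thesis
    by blast
qed

lemma orthogonal_factorization_system_CoCart:
  "orthogonal_factorization_system E (CoCart E B P, inverse_Iso E B P)"
proof -
  \<comment> \<open>Closure of this class under composition suffices, since it contains the
    isomorphisms by \<open>iso\<close>.\<close>
  have closed: "i \<cdot>\<^bsub>E\<^esub> f \<in> inverse_Iso E B P"
    if "f \<in> inverse_Iso E B P" "i \<in> inverse_Iso E B P" "Cod E f = Dom E i" for f i
    using that cod.Iso_Comp[of "farr P f" "farr P i"]
    by (auto simp: inverse_Iso_def dom.Comp_props farr_Comp' farr_props)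
  have iso: "i \<in> inverse_Iso E B P" "i \<in> Arr E" if "i \<in> Iso E" for i
    using that farr_Iso by (auto simp: inverse_Iso_def Iso_def)
  have vert: "Vert E B P \<subseteq> inverse_Iso E B P"
    using cod.identities_Iso by (auto simp: Vert_def inverse_Iso_def)
  have "\<exists>e\<in>CoCart E B P. \<exists>m\<in>inverse_Iso E B P. Cod E e = Dom E m \<and> f = m \<cdot>\<^bsub>E\<^esub> e"
    if f: "f \<in> Arr E" for f
    using right_factor_props[OF f] lift_props(6)[OF f] vert by (metis subsetD)
  moreover have "CoCart E B P \<subseteq> Arr E" "inverse_Iso E B P \<subseteq> Arr E"
    by (auto simp: CoCart_def inverse_Iso_def)
  ultimately show ?thesis
    unfolding orthogonal_factorization_system_def
    using CoCart_orthogonal_inverse_Iso closed iso CoCart_Comp Iso_CoCart by simp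
qed

end

theorem theorem6p9:
  fixes E :: "('eo, 'ea) cat" and B :: "('bo, 'ba) cat"
    and P :: "('eo, 'ea, 'bo, 'ba) funct" and \<delta> :: "'eo \<Rightarrow> 'ba \<Rightarrow> 'ea"
  assumes "split_cofibration E B P \<delta>"
  shows "(strict_S_algebra E (F_algebra E B P \<delta>) \<and>
          strict_factorization_system E (Delta E B P \<delta>, Vert E B P) \<and>
          corresponding_sfs E (F_algebra E B P \<delta>) = (Delta E B P \<delta>, Vert E B P)) \<and>
         (orthogonal_factorization_system E (CoCart E B P, inverse_Iso E B P) \<and>
          associated_ofs E (F_algebra E B P \<delta>) = (CoCart E B P, inverse_Iso E B P))"
proof -
  interpret split_cofibration E B P \<delta> by (rule assms)
  show ?thesis
    using strict_S_algebra_F_algebra strict_factorization_system_Delta_Vert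
      corresponding_sfs_F_algebra orthogonal_factorization_system_CoCart associated_ofs_F_algebra
    by blast
qed

end
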